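(* Let $R$ be a TRS over $sign(R)$, and let $\Sigma=\{f,\sharp\}\cup sign(R)$, where $f\in\Sigma_2-sign(R)$ and $\sharp\in\Sigma_0-sign(R)$. Then $R$ is an EP$\Sigma$RF-TRS if and only if $R$ is an EPRF-TRS.
   Context: A ranked alphabet $\Sigma$ is a finite set of symbols with ranks, $\Sigma_m$ the symbols of rank $m$; $X$ a countable set of variables, $T_\Sigma(X)$ the terms, $T_\Sigma$ the ground terms. A TRS $R$ is a finite set of rules $l\to r$ of terms with every variable of $r$ occurring in $l$; $sign(R)$ is the ranked alphabet of symbols in its rules. $R^*_\Gamma(L)=\{p\mid q\Rightarrow^*_R p,\ q\in L\}$ for $L\subseteq T_\Gamma$. A bottom-up tree automaton (bta) over $\Gamma$ is a finite automaton with states (treated as constants), final states, rules $\delta(a_1,\dots,a_n)\to a$ and $a\to a'$, recognizing the ground terms rewriting to a final state. $R$ is an EP$\Gamma$RF-TRS if for any given finite $L\subseteq T_\Gamma$ one can effectively construct a bta $\mathcal{C}$ over $\Gamma$ with $L(\mathcal{C})=R^*_\Gamma(L)$. $R$ is an EPRF-TRS if for any given ranked alphabet $\Gamma\supseteq sign(R)$ and finite $L\subseteq T_\Gamma$ one can effectively construct a bta $\mathcal{C}$ over $\Gamma$ with $L(\mathcal{C})=R^*_\Gamma(L)$. *)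

theory Defs
  imports Main "HOL-Library.Nat_Bijection"
begin

section \<open>Terms and rewriting\<close>

text \<open>
  A symbol is a name together with its rank, so every symbol has a unique rank, there are
  infinitely many symbols of each rank, and symbols can be inputs of an algorithm. A ranked
  alphabet is a finite set of symbols.
\<close>

datatype sym = Sym (sym_name: nat) (rank: nat)

datatype trm = Var nat | Fun sym "trm list"

primrec vars :: "trm \<Rightarrow> nat set" where
  "vars (Var x) = {x}"
| "vars (Fun g ts) = \<Union> (set (map vars ts))"

primrec syms :: "trm \<Rightarrow> sym set" where
  "syms (Var x) = {}"
| "syms (Fun g ts) = insert g (\<Union> (set (map syms ts)))"

primrec subst :: "(nat \<Rightarrow> trm) \<Rightarrow> trm \<Rightarrow> trm" where
  "subst \<sigma> (Var x) = \<sigma> x"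
| "subst \<sigma> (Fun g ts) = Fun g (map (subst \<sigma>) ts)"

inductive_set trms :: "sym set \<Rightarrow> trm set" for \<Sigma> :: "sym set" where
  Var: "Var x \<in> trms \<Sigma>"
| Fun: "\<lbrakk>g \<in> \<Sigma>; length ts = rank g; \<And>t. t \<in> set ts \<Longrightarrow> t \<in> trms \<Sigma>\<rbrakk> \<Longrightarrow> Fun g ts \<in> trms \<Sigma>"

definition ground_trms :: "sym set \<Rightarrow> trm set" where
  "ground_trms \<Sigma> = {t \<in> trms \<Sigma>. vars t = {}}"

type_synonym rules = "(trm \<times> trm) set"

definition sign :: "rules \<Rightarrow> sym set" where
  "sign R = (\<Union>(l, r) \<in> R. syms l \<union> syms r)"

text \<open>Left-hand sides are allowed to be variables.\<close>

definition is_trs :: "rules \<Rightarrow> bool" where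
  "is_trs R \<longleftrightarrow> finite R \<and>
     (\<forall>(l, r) \<in> R. l \<in> trms (sign R) \<and> r \<in> trms (sign R) \<and> vars r \<subseteq> vars l)"

inductive_set rstep :: "rules \<Rightarrow> (trm \<times> trm) set" for R :: rules where
  root: "(l, r) \<in> R \<Longrightarrow> (subst \<sigma> l, subst \<sigma> r) \<in> rstep R"
| ctxt: "(s, t) \<in> rstep R \<Longrightarrow> (Fun g (us @ s # vs), Fun g (us @ t # vs)) \<in> rstep R"

text \<open>
  The set \<open>R\<^sup>*\<^sub>\<Gamma>(L)\<close>. The alphabet is not an argument: for a TRS \<open>R\<close> with
  \<open>sign R \<subseteq> \<Gamma>\<close>, rewriting never leaves the set of ground terms over \<open>\<Gamma>\<close>.
\<close>

definition descendants :: "rules \<Rightarrow> trm set \<Rightarrow> trm set" where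
  "descendants R L = {p. \<exists>q \<in> L. (q, p) \<in> (rstep R)\<^sup>*}"


section \<open>Bottom-up tree automata\<close>

text \<open>
  States are symbols of rank 0 outside the input alphabet, so that the rules of an automaton
  form a ground rewrite system.
\<close>

record bta =
  states :: "sym set"
  finals :: "sym set"
  trans :: rules

definition is_bta :: "sym set \<Rightarrow> bta \<Rightarrow> bool" where
  "is_bta \<Gamma> C \<longleftrightarrow>
     finite (states C) \<and> (\<forall>a \<in> states C. rank a = 0) \<and> states C \<inter> \<Gamma> = {} \<and>
     finals C \<subseteq> states C \<and>
     finite (trans C) \<and>
     trans C \<subseteq>
       {(Fun d (map (\<lambda>a. Fun a []) as), Fun a []) | d as a.
          d \<in> \<Gamma> \<and> length as = rank d \<and> set as \<subseteq> states C \<and> a \<in> states C} \<union>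
       {(Fun a [], Fun a' []) | a a'. a \<in> states C \<and> a' \<in> states C}"

definition bta_lang :: "sym set \<Rightarrow> bta \<Rightarrow> trm set" where
  "bta_lang \<Gamma> C = {p \<in> ground_trms \<Gamma>. \<exists>a \<in> finals C. (p, Fun a []) \<in> (rstep (trans C))\<^sup>*}"


section \<open>Effectivity\<close>

text \<open>
  The total recursive functions, as unary functions on numbers with \<open>prod_encode\<close> as pairing:
  the least class containing the basic functions and closed under pairing, composition, primitive
  recursion and minimization of regular functions.
\<close>

inductive recursive :: "(nat \<Rightarrow> nat) \<Rightarrow> bool" where
  zero: "recursive (\<lambda>n. 0)"
| succ: "recursive Suc"
| left: "recursive (\<lambda>n. fst (prod_decode n))"
| right: "recursive (\<lambda>n. snd (prod_decode n))"
| pair: "\<lbrakk>recursive F; recursive G\<rbrakk> \<Longrightarrow> recursive (\<lambda>n. prod_encode (F n, G n))"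
| comp: "\<lbrakk>recursive F; recursive G\<rbrakk> \<Longrightarrow> recursive (\<lambda>n. F (G n))"
| prec: "\<lbrakk>recursive F; recursive G\<rbrakk> \<Longrightarrow>
    recursive (\<lambda>n. case prod_decode n of (x, m) \<Rightarrow>
      rec_nat (F x) (\<lambda>k y. G (prod_encode (x, prod_encode (k, y)))) m)"
| mini: "\<lbrakk>recursive F; \<forall>x. \<exists>y. F (prod_encode (x, y)) = 0\<rbrakk> \<Longrightarrow>
    recursive (\<lambda>x. LEAST y. F (prod_encode (x, y)) = 0)"

primrec sym_code :: "sym \<Rightarrow> nat" where
  "sym_code (Sym i m) = prod_encode (i, m)"

primrec trm_code :: "trm \<Rightarrow> nat" where
  "trm_code (Var x) = sum_encode (Inl x)"
| "trm_code (Fun g ts) =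
     sum_encode (Inr (prod_encode (sym_code g, list_encode (map trm_code ts))))"

definition rule_code :: "trm \<times> trm \<Rightarrow> nat" where
  "rule_code p = prod_encode (trm_code (fst p), trm_code (snd p))"

text \<open>The following codes are meaningful (and injective) for finite sets only.\<close>

definition alph_code :: "sym set \<Rightarrow> nat" where
  "alph_code A = set_encode (sym_code ` A)"

definition lang_code :: "trm set \<Rightarrow> nat" where
  "lang_code L = set_encode (trm_code ` L)"

definition bta_code :: "bta \<Rightarrow> nat" where
  "bta_code C = prod_encode (alph_code (states C),
     prod_encode (alph_code (finals C), set_encode (rule_code ` trans C)))"

text \<open>
  The behaviour of the algorithm \<open>F\<close> on numbers that do not encode admissible inputs is
  irrelevant; as admissibility is decidable, requiring \<open>F\<close> to be total is no restriction.
\<close>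

definition EPGRF_TRS :: "sym set \<Rightarrow> rules \<Rightarrow> bool" where
  "EPGRF_TRS \<Gamma> R \<longleftrightarrow>
     (\<exists>F. recursive F \<and>
        (\<forall>L. finite L \<and> L \<subseteq> ground_trms \<Gamma> \<longrightarrow>
           (\<exists>C. is_bta \<Gamma> C \<and> F (lang_code L) = bta_code C \<and>
              bta_lang \<Gamma> C = descendants R L)))"

text \<open>Here the alphabet is part of the input: one algorithm serves all alphabets.\<close>

definition EPRF_TRS :: "rules \<Rightarrow> bool" where
  "EPRF_TRS R \<longleftrightarrow>
     (\<exists>F. recursive F \<and>
        (\<forall>\<Gamma> L. finite \<Gamma> \<and> sign R \<subseteq> \<Gamma> \<and> finite L \<and> L \<subseteq> ground_trms \<Gamma> \<longrightarrow>
           (\<exists>C. is_bta \<Gamma> C \<and> F (prod_encode (alph_code \<Gamma>, lang_code L)) = bta_code C \<and>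
              bta_lang \<Gamma> C = descendants R L)))"

end

theory Submission
  imports Defs
begin

text \<open>
  A symbol of \<open>\<Gamma>\<close> outside \<open>sign R\<close> can be represented by a block of \<open>f\<close> and \<open>sharp\<close> that
  starts with the code of the symbol in unary. As \<open>R\<close> mentions neither \<open>f\<close> nor \<open>sharp\<close>, its
  reductions between encoded terms are those between the original terms, so \<open>R\<^sup>*(L)\<close> is the
  inverse image of \<open>R\<^sup>*(enc L)\<close> under a tree homomorphism. An automaton for it is obtained by
  letting one rule for a symbol simulate the runs of the given automaton on the block of the symbol.
  For effectivity, closure of the recursive functions under bounded comprehension of coded sets and
  under course-of-values recursion is enough: reachability by rules \<open>a \<rightarrow> a'\<close> is a
  bounded quantification over coded sets of states.
\<close>

section \<open>Recursive functions and decidable predicates\<close>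

text \<open>Two obstacles shape the proof. Rules may have a variable as left-hand side, so they also
  apply inside a block, and the image of \<open>enc\<close> is not closed under rewriting. A decoder
  that is defined on all terms, maps reductions to reductions and is a left inverse of
  \<open>enc\<close> is enough, because the inverse image only asks about reducts that are
  encodings. Second, one algorithm must serve all alphabets, whose symbols have unbounded rank and
  may include \<open>f\<close> and \<open>sharp\<close>. Hence the number in a block codes name and
  rank together, and \<open>f\<close> and \<open>sharp\<close> are themselves turned into blocks
  when they occur in \<open>\<Gamma>\<close>: every \<open>f\<close> in an encoding belongs to a
  block. As \<open>R\<close>, \<open>f\<close> and \<open>sharp\<close> are fixed,
  \<open>sign R\<close> is a constant of the algorithm; the codes of the alphabet, the language and
  the resulting automaton vary.\<close>

abbreviation pfst :: "nat \<Rightarrow> nat" where "pfst n \<equiv> fst (prod_decode n)"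
abbreviation psnd :: "nat \<Rightarrow> nat" where "psnd n \<equiv> snd (prod_decode n)"

lemma recursive_id: "recursive (\<lambda>x. x)"
  using recursive.pair[OF recursive.left recursive.right] by simp

lemma recursive_const: "recursive (\<lambda>_. c)"
proof (induction c)
  case 0
  show ?case by (rule recursive.zero)
next
  case (Suc c)
  show ?case using recursive.comp[OF recursive.succ Suc] .
qed

lemma recursive_pfst: "recursive F \<Longrightarrow> recursive (\<lambda>x. pfst (F x))"
  by (rule recursive.comp[OF recursive.left])

lemma recursive_psnd: "recursive F \<Longrightarrow> recursive (\<lambda>x. psnd (F x))"
  by (rule recursive.comp[OF recursive.right])

lemma recursive_Suc: "recursive F \<Longrightarrow> recursive (\<lambda>x. Suc (F x))"
  by (rule recursive.comp[OF recursive.succ])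

named_theorems rec_intros

lemmas [rec_intros] = recursive_id recursive_const recursive_pfst recursive_psnd recursive_Suc
  recursive.pair

text \<open>\<open>recursive\<close> speaks of unary functions, so a curried function enters as its
  composition with projections. These rules put arbitrary arguments back in place.\<close>

lemma recursive2:
  assumes "recursive (\<lambda>z. h (pfst z) (psnd z))" "recursive A" "recursive B"
  shows "recursive (\<lambda>x. h (A x) (B x))"
  using recursive.comp[OF assms(1) recursive.pair[OF assms(2,3)]] by simp

lemma recursive3:
  assumes "recursive (\<lambda>z. h (pfst z) (pfst (psnd z)) (psnd (psnd z)))"
    "recursive A" "recursive B" "recursive C"
  shows "recursive (\<lambda>x. h (A x) (B x) (C x))"
  using recursive.comp[OF assms(1) recursive.pair[OF assms(2) recursive.pair[OF assms(3,4)]]] by simp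

text \<open>The whole input \<open>x\<close> serves as the parameter of the recursion, so that
  start, step and number of iterations may all depend on it.\<close>

lemma recursive_rec_nat [rec_intros]:
  assumes A: "recursive A" and B: "recursive (\<lambda>z. B (pfst z) (pfst (psnd z)) (psnd (psnd z)))"
    and n: "recursive n"
  shows "recursive (\<lambda>x. rec_nat (A x) (\<lambda>k y. B x k y) (n x))"
proof -
  note pr = recursive.prec[OF A B]
  have "recursive (\<lambda>x. prod_encode (x, n x))"
    by (intro rec_intros n)
  from recursive.comp[OF pr this] show ?thesis by simp
qed

lemma recursive_add [rec_intros]:
  assumes "recursive F" "recursive G"
  shows "recursive (\<lambda>x. F x + G x)"
proof -
  have "rec_nat a (\<lambda>k y. Suc y) n = a + n" for a n by (induction n) auto
  then have "(\<lambda>x. F x + G x) = (\<lambda>x. rec_nat (F x) (\<lambda>k y. Suc y) (G x))" by simp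
  then show ?thesis by (simp only:) (intro rec_intros assms)
qed

lemma recursive_mult [rec_intros]:
  assumes "recursive F" "recursive G"
  shows "recursive (\<lambda>x. F x * G x)"
proof -
  have "rec_nat 0 (\<lambda>k y. y + a) n = a * n" for a n :: nat by (induction n) auto
  then have "(\<lambda>x. F x * G x) = (\<lambda>x. rec_nat 0 (\<lambda>k y. y + F x) (G x))" by simp
  \<comment> \<open>In the step of the recursion \<open>x\<close> is a projection of the coded
    argument, so \<open>F\<close> appears composed with it; hence
    \<open>assms[THEN recursive.comp]\<close>.\<close>
  then show ?thesis
    by (simp only:) (intro rec_intros assms assms[THEN recursive.comp])
qed

lemma recursive_power [rec_intros]:
  assumes "recursive F" "recursive G"
  shows "recursive (\<lambda>x. F x ^ G x)"
proof -
  have "rec_nat 1 (\<lambda>k y. y * a) n = a ^ n" for a n :: nat by (induction n) auto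
  then have "(\<lambda>x. F x ^ G x) = (\<lambda>x. rec_nat 1 (\<lambda>k y. y * F x) (G x))" by simp
  then show ?thesis
    by (simp only:) (intro rec_intros assms assms[THEN recursive.comp])
qed

lemma recursive_diff [rec_intros]:
  assumes "recursive F" "recursive G"
  shows "recursive (\<lambda>x. F x - G x)"
proof -
  have pred: "rec_nat 0 (\<lambda>k y. k) n = n - 1" for n by (cases n) auto
  have "rec_nat a (\<lambda>k y. rec_nat 0 (\<lambda>k y. k) y) n = a - n" for a n :: nat
    by (induction n) (auto simp: pred)
  then have "(\<lambda>x. F x - G x) = (\<lambda>x. rec_nat (F x) (\<lambda>k y. rec_nat 0 (\<lambda>k y. k) y) (G x))" by simp
  then show ?thesis by (simp only:) (intro rec_intros assms)
qed

lemma recursive_sum [rec_intros]: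
  assumes F: "recursive (\<lambda>z. F (pfst z) (psnd z))" and n: "recursive n"
  shows "recursive (\<lambda>x. \<Sum>i<n x. F x i)"
proof -
  have "rec_nat 0 (\<lambda>k y. y + g k) n = (\<Sum>i<n. g i)" for g :: "nat \<Rightarrow> nat" and n
    by (induction n) auto
  then have eq: "(\<lambda>x. \<Sum>i<n x. F x i) = (\<lambda>x. rec_nat 0 (\<lambda>k y. y + F x k) (n x))" by simp
  show ?thesis unfolding eq by (intro rec_intros n recursive2[OF F])
qed

definition decidable :: "(nat \<Rightarrow> bool) \<Rightarrow> bool" where
  "decidable P \<longleftrightarrow> recursive (\<lambda>x. of_bool (P x))"

lemma decidable_not [rec_intros]: "decidable P \<Longrightarrow> decidable (\<lambda>x. \<not> P x)"
proof -
  assume P: "decidable P"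
  have "(\<lambda>x. of_bool (\<not> P x)) = (\<lambda>x. 1 - of_bool (P x) :: nat)" by auto
  then show ?thesis using P unfolding decidable_def by (auto intro!: rec_intros)
qed

lemma decidable_conj [rec_intros]:
  "decidable P \<Longrightarrow> decidable Q \<Longrightarrow> decidable (\<lambda>x. P x \<and> Q x)"
  unfolding decidable_def of_bool_conj by (intro rec_intros)

lemma decidable_disj [rec_intros]:
  assumes "decidable P" "decidable Q" shows "decidable (\<lambda>x. P x \<or> Q x)"
proof -
  have "decidable (\<lambda>x. \<not> (\<not> P x \<and> \<not> Q x))" by (intro rec_intros assms)
  then show ?thesis by simp
qed

lemma decidable_imp [rec_intros]:
  assumes "decidable P" "decidable Q" shows "decidable (\<lambda>x. P x \<longrightarrow> Q x)"
proof -
  have "decidable (\<lambda>x. \<not> P x \<or> Q x)" by (intro rec_intros assms)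
  then show ?thesis by (simp only: imp_conv_disj)
qed

lemma decidable_less [rec_intros]:
  assumes "recursive F" "recursive G" shows "decidable (\<lambda>x. F x < G x)"
proof -
  have eq: "(\<lambda>x. of_bool (F x < G x)) = (\<lambda>x. 1 - (1 - (G x - F x)))" by auto
  show ?thesis unfolding decidable_def eq by (intro rec_intros assms)
qed

lemma decidable_eq [rec_intros]:
  assumes "recursive F" "recursive G" shows "decidable (\<lambda>x. F x = G x)"
proof -
  have "decidable (\<lambda>x. \<not> F x < G x \<and> \<not> G x < F x)" by (intro rec_intros assms)
  then show ?thesis by (simp add: not_less eq_iff conj_commute)
qed

lemma recursive_if [rec_intros]:
  assumes "decidable P" "recursive F" "recursive G"
  shows "recursive (\<lambda>x. if P x then F x else G x)"
proof -
  have eq: "(\<lambda>x. if P x then F x else G x) = (\<lambda>x. of_bool (P x) * F x + (1 - of_bool (P x)) * G x)"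
    by auto
  show ?thesis unfolding eq using assms(1)[unfolded decidable_def] by (intro rec_intros assms(2,3))
qed

lemma decidable_bex [rec_intros]:
  assumes P: "decidable (\<lambda>z. P (pfst z) (psnd z))" and n: "recursive n"
  shows "decidable (\<lambda>x. \<exists>y. y < n x \<and> P x y)"
proof -
  have "(\<lambda>x. \<exists>y. y < n x \<and> P x y) = (\<lambda>x. 0 < (\<Sum>y<n x. of_bool (P x y) :: nat))"
    by (auto simp: fun_eq_iff card_gt_0_iff)
  then show ?thesis using P[unfolded decidable_def]
    by (simp only:) (intro rec_intros n)
qed

lemma decidable_ball [rec_intros]:
  assumes P: "decidable (\<lambda>z. P (pfst z) (psnd z))" and n: "recursive n"
  shows "decidable (\<lambda>x. \<forall>y. y < n x \<longrightarrow> P x y)"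
proof -
  have "decidable (\<lambda>x. \<not> (\<exists>y. y < n x \<and> \<not> P x y))" by (intro rec_intros n P)
  then show ?thesis by simp
qed

lemma recursive_div [rec_intros]:
  assumes "recursive F" "recursive G"
  shows "recursive (\<lambda>x. F x div G x)"
proof -
  \<comment> \<open>The quotient counts the multiples d, 2d, ... that are at most \<open>m\<close>;
    the guard covers \<open>m div 0 = 0\<close>.\<close>
  have "m div d = (\<Sum>q<m. if 0 < d \<and> Suc q * d < Suc m then 1 else 0)" for m d :: nat
  proof (cases "0 < d")
    case True
    have "{q. q < m \<and> Suc q * d < Suc m} = {..<m div d}"
    proof (intro set_eqI, simp only: mem_Collect_eq lessThan_iff)
      fix q
      have "Suc q * d < Suc m \<longleftrightarrow> Suc q \<le> m div d"
        using True by (metis less_Suc_eq_le less_eq_div_iff_mult_less_eq)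
      moreover have "q < m" if "Suc q \<le> m div d" using that
        by (meson Suc_le_lessD div_le_dividend order_less_le_trans)
      ultimately show "(q < m \<and> Suc q * d < Suc m) = (q < m div d)" by auto
    qed
    then have "m div d = card {q \<in> {..<m}. Suc q * d < Suc m}" by simp
    then show ?thesis using True by (simp add: sum.If_cases Int_def)
  qed simp
  then have eq: "(\<lambda>x. F x div G x) =
      (\<lambda>x. \<Sum>q<F x. if 0 < G x \<and> Suc q * G x < Suc (F x) then 1 else 0)"
    by simp
  show ?thesis unfolding eq by (intro rec_intros assms assms[THEN recursive.comp])
qed

lemma decidable_odd [rec_intros]: "recursive F \<Longrightarrow> decidable (\<lambda>x. odd (F x))"
proof -
  assume "recursive F"
  then have "decidable (\<lambda>x. F x \<noteq> 2 * (F x div 2))" by (intro rec_intros)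
  moreover have "odd m \<longleftrightarrow> m \<noteq> 2 * (m div 2)" for m :: nat by presburger
  ultimately show ?thesis by (simp only:)
qed

section \<open>Finite sets coded as numbers\<close>

lemma decidable_mem [rec_intros]:
  assumes "recursive F" "recursive G"
  shows "decidable (\<lambda>x. F x \<in> set_decode (G x))"
  unfolding set_decode_def mem_Collect_eq by (intro rec_intros assms)

lemma recursive_collect [rec_intros]:
  assumes P: "decidable (\<lambda>z. P (pfst z) (psnd z))" and n: "recursive n"
  shows "recursive (\<lambda>x. set_encode {i. i < n x \<and> P x i})"
proof -
  have "set_encode {i. i < m \<and> Q i} = (\<Sum>i<m. of_bool (Q i) * 2 ^ i)" for m Q
  proof -
    have "set_encode {i. i < m \<and> Q i} = (\<Sum>i\<in>{i\<in>{..<m}. Q i}. 2 ^ i)"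
      by (simp add: set_encode_def)
    also have "\<dots> = (\<Sum>i<m. if Q i then 2 ^ i else 0)" by (rule sum.inter_filter) simp
    also have "\<dots> = (\<Sum>i<m. of_bool (Q i) * 2 ^ i)" by (rule sum.cong) auto
    finally show ?thesis .
  qed
  then have eq: "(\<lambda>x. set_encode {i. i < n x \<and> P x i}) =
      (\<lambda>x. \<Sum>i<n x. of_bool (P x i) * 2 ^ i)" by simp
  show ?thesis unfolding eq
    by (intro rec_intros n P[unfolded decidable_def])
qed

text \<open>If bit \<open>i\<close> of \<open>n\<close> is set, then
  \<open>i < 2 ^ i \<le> n\<close>. This bounds every quantifier over a coded set by the
  code.\<close>

lemma mem_set_decode_less: "i \<in> set_decode n \<Longrightarrow> i < n"
proof -
  assume "i \<in> set_decode n"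
  then have "n div 2 ^ i \<noteq> 0" by (auto simp: set_decode_def intro: Nat.gr0I)
  then have "2 ^ i \<le> n" by (metis div_less not_less)
  then show "i < n" using less_exp[of i] by (meson order_less_le_trans)
qed

lemma recursive_image [rec_intros]:
  assumes P: "decidable (\<lambda>z. P (pfst z) (psnd z))" and n: "recursive n"
    and h: "recursive (\<lambda>z. h (pfst z) (psnd z))"
  shows "recursive (\<lambda>x. set_encode ((\<lambda>i. h x i) ` {i. i < n x \<and> P x i}))"
proof -
  \<comment> \<open>The sum of all values bounds each of them, which makes the image a bounded
    comprehension.\<close>
  have bound: "h x i < Suc (\<Sum>i<n x. h x i)" if "i < n x" for x i
    using that by (simp add: less_Suc_eq_le member_le_sum)
  have eq: "(\<lambda>i. h x i) ` {i. i < n x \<and> P x i} =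
      {j. j < Suc (\<Sum>i<n x. h x i) \<and> (\<exists>i. i < n x \<and> P x i \<and> j = h x i)}" for x
    using bound by auto
  show ?thesis unfolding eq
    by (intro rec_intros n n[THEN recursive.comp] recursive2[OF h] recursive2[OF P[unfolded decidable_def]]
        decidable_def[THEN iffD2])
qed

text \<open>The table of all earlier values, newest first, is computed by primitive recursion: each
  step adds one element in front. Three lookups are what the encoding of terms needs.\<close>

lemma recursive_course_of_values:
  fixes F :: "nat \<Rightarrow> nat \<Rightarrow> nat"
  assumes zero: "recursive (\<lambda>x. F x 0)"
    and step: "\<And>x n. F x (Suc n) = G x n (F x (p n)) (F x (q n)) (F x (r n))"
    and less: "\<And>n. p n \<le> n" "\<And>n. q n \<le> n" "\<And>n. r n \<le> n"
    and rec: "recursive p" "recursive q" "recursive r"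
    and G: "recursive (\<lambda>z. G (pfst z) (pfst (psnd z)) (pfst (psnd (psnd z)))
      (pfst (psnd (psnd (psnd z)))) (psnd (psnd (psnd (psnd z)))))"
    and x: "recursive x" and n: "recursive n"
  shows "recursive (\<lambda>y. F (x y) (n y))"
proof -
  define T where "T x n = list_encode (map (F x) (rev [0..<Suc n]))" for x n
  \<comment> \<open>A nonempty list code is the successor of a pair of head and tail, so
    \<open>psnd (u - 1)\<close> drops the head.\<close>
  define look where "look t k = pfst (rec_nat t (\<lambda>_ u. psnd (u - 1)) k - 1)" for t k :: nat
  have look: "look (list_encode us) k = us ! k" if "k < length us" for us k
  proof -
    have drop: "rec_nat (list_encode us) (\<lambda>_ u. psnd (u - 1)) k = list_encode (drop k us)"
      if "k \<le> length us" for k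
      using that by (induction k) (auto simp flip: Cons_nth_drop_Suc)
    from that have "drop k us = us ! k # drop (Suc k) us" by (simp add: Cons_nth_drop_Suc)
    with drop[of k] that show ?thesis by (simp add: look_def)
  qed
  have T_look: "look (T x n) (n - i) = F x i" if "i \<le> n" for x n i
    using that by (simp add: T_def look rev_map[symmetric] rev_nth del: upt_Suc)
  have T_Suc: "T x (Suc n) = Suc (prod_encode (F x (Suc n), T x n))" for x n
    by (simp add: T_def)
  let ?B = "\<lambda>x n t. Suc (prod_encode (G x n (look t (n - p n)) (look t (n - q n)) (look t (n - r n)), t))"
  have T_rec: "T x n = rec_nat (Suc (prod_encode (F x 0, 0))) (?B x) n" for x n
  proof (induction n)
    case 0
    show ?case by (simp add: T_def)
  next
    case (Suc n)
    have "T x (Suc n) = ?B x n (T x n)"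
      by (simp only: T_Suc step T_look less)
    also have "\<dots> = ?B x n (rec_nat (Suc (prod_encode (F x 0, 0))) (?B x) n)"
      by (simp only: Suc)
    finally show ?case by (simp only: nat.rec)
  qed
  have lk: "recursive (\<lambda>z. look (A z) (B z))" if "recursive A" "recursive B" for A B
    unfolding look_def by (intro rec_intros that)
  have G': "recursive (\<lambda>z. G (A z) (B z) (C z) (D z) (E z))"
    if "recursive A" "recursive B" "recursive C" "recursive D" "recursive E" for A B C D E
    using recursive.comp[OF G recursive.pair[OF that(1) recursive.pair[OF that(2)
          recursive.pair[OF that(3) recursive.pair[OF that(4,5)]]]]] by simp
  have F_T: "F x n = pfst (T x n - 1)" for x n
    by (cases n) (simp_all add: T_def)
  have eq: "(\<lambda>y. F (x y) (n y)) =
      (\<lambda>y. pfst (rec_nat (Suc (prod_encode (F (x y) 0, 0))) (?B (x y)) (n y) - 1))"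
    by (rule ext) (rule F_T[unfolded T_rec])
  show ?thesis unfolding eq
    by (intro rec_intros n lk G' x[THEN recursive.comp] rec[THEN recursive.comp]
        recursive.comp[OF zero x])
qed

section \<open>Functions on coded lists\<close>

lemma le_prod_decode: "pfst n \<le> n" "psnd n \<le> n"
  using le_prod_encode_1[of "pfst n" "psnd n"] le_prod_encode_2[of "psnd n" "pfst n"] by simp_all

text \<open>The list code \<open>Suc n\<close> has the tail code \<open>psnd n\<close>, which is
  smaller, so folding is a course-of-values recursion on the code. All three lookups ask for the
  tail.\<close>

lemma recursive_foldr [rec_intros]:
  assumes B: "recursive B" and l: "recursive l"
    and S: "recursive (\<lambda>z. S (pfst z) (pfst (psnd z)) (psnd (psnd z)))"
  shows "recursive (\<lambda>x. foldr (\<lambda>a u. S x a u) (list_decode (l x)) (B x))"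
proof (rule recursive_course_of_values[where F = "\<lambda>x m. foldr (S x) (list_decode m) (B x)" and
      x = "\<lambda>x. x" and n = l and p = psnd and q = psnd and r = psnd
      and G = "\<lambda>x n a b c. S x (pfst n) a"])
  show "foldr (S x) (list_decode (Suc n)) (B x) =
      S x (pfst n) (foldr (S x) (list_decode (psnd n)) (B x))" for x n
    by (simp add: case_prod_unfold)
  show "recursive (\<lambda>z. S (pfst z) (pfst (pfst (psnd z))) (pfst (psnd (psnd z))))"
    by (intro rec_intros recursive3[OF S])
  show "recursive (\<lambda>x. foldr (S x) (list_decode 0) (B x))" using B by simp
qed (rule le_prod_decode recursive.right recursive_id l)+

lemma recursive_map [rec_intros]:
  assumes h: "recursive (\<lambda>z. h (pfst z) (psnd z))" and l: "recursive l"
  shows "recursive (\<lambda>x. list_encode (map (\<lambda>a. h x a) (list_decode (l x))))"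
proof -
  have eq: "list_encode (map g us) = foldr (\<lambda>a u. Suc (prod_encode (g a, u))) us 0" for g us
    by (induction us) auto
  show ?thesis unfolding eq by (intro rec_intros l recursive2[OF h])
qed

lemma recursive_length [rec_intros]:
  assumes "recursive l" shows "recursive (\<lambda>x. length (list_decode (l x)))"
proof -
  have eq: "length us = foldr (\<lambda>a u. Suc u) us 0" for us :: "nat list" by (induction us) auto
  show ?thesis unfolding eq by (intro rec_intros assms)
qed

lemma decidable_list_all [rec_intros]:
  assumes P: "decidable (\<lambda>z. P (pfst z) (psnd z))" and l: "recursive l"
  shows "decidable (\<lambda>x. \<forall>a\<in>set (list_decode (l x)). P x a)"
proof -
  have eq: "of_bool (\<forall>a\<in>set us. Q a) = foldr (\<lambda>a u. of_bool (Q a) * u) us (1::nat)" for Q us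
    by (induction us) (simp_all add: of_bool_conj)
  show ?thesis unfolding decidable_def eq
    by (intro rec_intros l recursive2[OF P[unfolded decidable_def]])
qed

section \<open>Rewriting blocks\<close>

definition sym_decode :: "nat \<Rightarrow> sym" where
  "sym_decode n = Sym (pfst n) (psnd n)"

lemma sym_decode_code [simp]: "sym_decode (sym_code g) = g"
  by (cases g) (simp add: sym_decode_def)

lemma sym_code_decode [simp]: "sym_code (sym_decode n) = n"
  by (simp add: sym_decode_def)

lemma inj_sym_code: "inj sym_code"
  by (rule inj_on_inverseI[of _ sym_decode]) simp

section \<open>Rewriting in contexts and on ground terms\<close>

lemma rsteps_ctxt:
  "(s, t) \<in> (rstep R)\<^sup>* \<Longrightarrow> (Fun g (us @ s # vs), Fun g (us @ t # vs)) \<in> (rstep R)\<^sup>*"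
  by (induction rule: rtrancl_induct) (auto intro: rtrancl.rtrancl_into_rtrancl rstep.ctxt)

lemma rsteps_args:
  assumes "list_all2 (\<lambda>s t. (s, t) \<in> (rstep R)\<^sup>*) ss ts"
  shows "(Fun g ss, Fun g ts) \<in> (rstep R)\<^sup>*"
proof -
  have "(Fun g (us @ ss), Fun g (us @ ts)) \<in> (rstep R)\<^sup>*" for us
    using assms
  proof (induction arbitrary: us rule: list_all2_induct)
    case (Cons s ss t ts)
    have "(Fun g (us @ s # ss), Fun g (us @ t # ss)) \<in> (rstep R)\<^sup>*"
      by (rule rsteps_ctxt) (rule Cons.hyps)
    also have "(Fun g (us @ t # ss), Fun g (us @ t # ts)) \<in> (rstep R)\<^sup>*"
      using Cons.IH[of "us @ [t]"] by simp
    finally show ?case .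
  qed simp
  from this[of "[]"] show ?thesis by simp
qed

lemma is_trs_syms: "is_trs R \<Longrightarrow> (l, r) \<in> R \<Longrightarrow> syms l \<subseteq> sign R \<and> syms r \<subseteq> sign R"
  by (auto simp: sign_def)

lemma ground_Fun:
  "Fun g ts \<in> ground_trms \<Gamma> \<longleftrightarrow> g \<in> \<Gamma> \<and> length ts = rank g \<and> set ts \<subseteq> ground_trms \<Gamma>"
  by (auto simp: ground_trms_def elim: trms.cases intro!: trms.Fun)

lemma ground_induct [consumes 1, case_names Fun]:
  assumes "t \<in> ground_trms \<Gamma>"
    and "\<And>g ts. g \<in> \<Gamma> \<Longrightarrow> length ts = rank g \<Longrightarrow> set ts \<subseteq> ground_trms \<Gamma> \<Longrightarrow>
      (\<And>t. t \<in> set ts \<Longrightarrow> P t) \<Longrightarrow> P (Fun g ts)"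
  shows "P t"
  using assms(1)
proof (induction t)
  case (Var x)
  then show ?case by (simp add: ground_trms_def)
next
  case (Fun g ts)
  then have "g \<in> \<Gamma>" "length ts = rank g" "set ts \<subseteq> ground_trms \<Gamma>" by (simp_all add: ground_Fun)
  with Fun.IH show ?case by (intro assms(2)) auto
qed

lemma subst_ground_trms:
  assumes "t \<in> trms \<Gamma>" "\<And>x. x \<in> vars t \<Longrightarrow> \<sigma> x \<in> ground_trms \<Gamma>"
  shows "subst \<sigma> t \<in> ground_trms \<Gamma>"
  using assms
  by (induction) (auto simp: ground_Fun)

lemma ground_subst_vars:
  "subst \<sigma> t \<in> ground_trms \<Gamma> \<Longrightarrow> x \<in> vars t \<Longrightarrow> \<sigma> x \<in> ground_trms \<Gamma>"
proof (induction t)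
  case (Fun g ts)
  then show ?case by (force simp: ground_trms_def elim: trms.cases)
qed simp

lemma trms_mono: "t \<in> trms \<Delta> \<Longrightarrow> \<Delta> \<subseteq> \<Gamma> \<Longrightarrow> t \<in> trms \<Gamma>"
  by (induction rule: trms.induct) (auto intro!: trms.intros)

lemma ground_rsteps:
  assumes "(s, t) \<in> (rstep R)\<^sup>*" "is_trs R" "sign R \<subseteq> \<Gamma>" "s \<in> ground_trms \<Gamma>"
  shows "t \<in> ground_trms \<Gamma>"
proof -
  have step: "t \<in> ground_trms \<Gamma>" if "(s, t) \<in> rstep R" "s \<in> ground_trms \<Gamma>" for s t
    using that
  proof induction
    case (root l r \<sigma>)
    then have "r \<in> trms \<Gamma>" "vars r \<subseteq> vars l"
      using assms(2,3) by (auto simp: is_trs_def intro: trms_mono)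
    with root show ?case by (auto intro: subst_ground_trms ground_subst_vars)
  next
    case (ctxt s t g us vs)
    then show ?case by (auto simp: ground_trms_def elim!: trms.cases intro!: trms.Fun)
  qed
  show ?thesis using assms(1,4) by (induction rule: rtrancl_induct) (auto intro: step)
qed

lemma finite_sign: "is_trs R \<Longrightarrow> finite (sign R)"
proof -
  have "finite (syms t)" for t by (induction t) auto
  then show "is_trs R \<Longrightarrow> finite (sign R)" by (auto simp: is_trs_def sign_def)
qed

section \<open>Encoding by blocks and decoding of arbitrary terms\<close>

locale block_encoding =
  fixes R :: rules and f sharp :: sym
  assumes trs: "is_trs R"
    and f: "rank f = 2" "f \<notin> sign R"
    and sharp: "rank sharp = 0" "sharp \<notin> sign R"
begin

lemma f_neq_sharp [simp]: "f \<noteq> sharp" "sharp \<noteq> f"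
  using f(1) sharp(1) by auto

text \<open>Lists built from a pairing symbol and an end marker, so that one binary symbol and one
  constant suffice for every rank.\<close>

primrec chain :: "trm list \<Rightarrow> trm" where
  "chain [] = Fun sharp []"
| "chain (t # ts) = Fun f [t, chain ts]"

text \<open>A number is a chain too, so the same decoder reads both halves of a block; the number is
  the length of the chain.\<close>

abbreviation num :: "nat \<Rightarrow> trm" where
  "num i \<equiv> chain (replicate i (Fun sharp []))"

text \<open>
  A symbol outside \<open>sign R\<close> becomes a block \<open>f(num i, chain(t\<^sub>1, \<dots>, t\<^sub>n))\<close>, where
  \<open>i\<close> is the code of the symbol. In particular the encoding does not depend on the alphabet.
\<close>

primrec enc :: "trm \<Rightarrow> trm" where
  "enc (Var x) = Var x"
| "enc (Fun g ts) = (if g \<in> sign R then Fun g (map enc ts)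
     else Fun f [num (sym_code g), chain (map enc ts)])"

text \<open>
  Rules with a variable as left-hand side also rewrite inside of a block, which may destroy it.
  The decoder copes with this by treating blocks as linear in their inner positions: it moves a
  symbol \<open>h\<close> of \<open>sign R\<close> found at such a position out of the block,
  \<open>f(h(u\<^sub>1, \<dots>, u\<^sub>n), v) \<mapsto> h(f(u\<^sub>1, v), \<dots>, f(u\<^sub>n, v))\<close>. A step inside of the block thus
  becomes a step outside. The first component decodes a term, the second one decodes a term in the
  position of a chain and hands the list of elements of the chain to a continuation.
\<close>

primrec decode :: "trm \<Rightarrow> trm \<times> ((trm list \<Rightarrow> trm) \<Rightarrow> trm)" where
  "decode (Var x) = (Var x, \<lambda>k. Var x)"
| "decode (Fun g ts) =
    (if g = f \<and> length ts = 2
     then snd (map decode ts ! 0) (\<lambda>ns. snd (map decode ts ! 1) (\<lambda>us. Fun (sym_decode (length ns)) us))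
     else Fun g (map (fst \<circ> decode) ts),
     \<lambda>k. if g = f \<and> length ts = 2 then snd (map decode ts ! 1) (\<lambda>us. k (fst (map decode ts ! 0) # us))
      else if g = sharp then k []
      else Fun g (map (\<lambda>t. snd (decode t) k) ts))"

abbreviation dec :: "trm \<Rightarrow> trm" where "dec t \<equiv> fst (decode t)"
abbreviation dech :: "trm \<Rightarrow> (trm list \<Rightarrow> trm) \<Rightarrow> trm" where "dech t \<equiv> snd (decode t)"

lemma dech_chain: "dech (chain ts) k = k (map dec ts)"
  by (induction ts arbitrary: k) auto

lemma dec_enc: "dec (enc t) = t"
proof (induction t)
  case (Fun g ts)
  then have "map (\<lambda>t. dec (enc t)) ts = ts" by (simp add: map_idI)
  then show ?case using f(2) by (auto simp: dech_chain comp_def)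
qed simp

text \<open>A pattern over \<open>sign R\<close> contains neither \<open>f\<close> nor
  \<open>sharp\<close>, so both components pass through it down to the variables. For
  \<open>dech\<close>, a redex in a chain position thus becomes a redex of the same rule outside of
  the block.\<close>

lemma dec_subst:
  assumes "syms l \<subseteq> sign R"
  shows "dec (subst \<sigma> l) = subst (\<lambda>x. dec (\<sigma> x)) l"
    and "dech (subst \<sigma> l) k = subst (\<lambda>x. dech (\<sigma> x) k) l"
  using assms f(2) sharp(2) by (induction l) (auto simp: UN_subset_iff)

abbreviation rsteps :: "trm \<Rightarrow> trm \<Rightarrow> bool" (infix "\<rightarrow>*" 50) where
  "s \<rightarrow>* t \<equiv> (s, t) \<in> (rstep R)\<^sup>*"

text \<open>Moving a symbol out of a block copies the continuation into each of its arguments.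
  Reducing all copies takes any number of steps, possibly none, which is why decoding turns one step
  into a reduction.\<close>

lemma dech_mono:
  assumes "\<And>us. k us \<rightarrow>* k' us"
  shows "dech t k \<rightarrow>* dech t k'"
  using assms
proof (induction t arbitrary: k k')
  case (Fun g ts)
  show ?case
  proof (cases "g = f \<and> length ts = 2")
    case True
    then have "ts ! 1 \<in> set ts" by simp
    then have "dech (ts ! 1) (\<lambda>us. k (dec (ts ! 0) # us)) \<rightarrow>* dech (ts ! 1) (\<lambda>us. k' (dec (ts ! 0) # us))"
      using Fun.prems by (rule Fun.IH)
    then show ?thesis using True by auto
  next
    case False
    then show ?thesis
      by (auto simp: list_all2_conv_all_nth intro!: Fun rsteps_args)
  qed
qed simp

text \<open>What a continuation must satisfy for a step in an element of a chain to survive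
  decoding. The continuations in \<open>dec\<close> do: one looks at the length of its list only,
  the other puts its list below a symbol.\<close>

definition mono_cont :: "(trm list \<Rightarrow> trm) \<Rightarrow> bool" where
  "mono_cont k \<longleftrightarrow> (\<forall>us s t vs. s \<rightarrow>* t \<longrightarrow> k (us @ s # vs) \<rightarrow>* k (us @ t # vs))"

lemma dec_step:
  assumes "(s, t) \<in> rstep R"
  shows "dec s \<rightarrow>* dec t \<and> (\<forall>k. mono_cont k \<longrightarrow> dech s k \<rightarrow>* dech t k)"
  using assms
proof induction
  case (root l r \<sigma>)
  then have "syms l \<subseteq> sign R" "syms r \<subseteq> sign R" using is_trs_syms[OF trs] by auto
  then show ?case using root by (auto simp: dec_subst intro!: r_into_rtrancl rstep.root)
next
  case (ctxt s t g us vs)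
  show ?case
  proof (cases "g = f \<and> length (us @ s # vs) = 2")
    case True
    then consider v where "us = []" "vs = [v]" | u where "us = [u]" "vs = []"
      by (cases us; cases vs) (auto simp: length_Suc_conv numeral_2_eq_2)
    then show ?thesis
    proof cases
      \<comment> \<open>\<open>dec\<close> reads the first argument of \<open>f\<close> as the
        numeral of a block, \<open>dech\<close> reads it as an element of a chain. The second
        argument is a chain for both.\<close>
      case 1
      have "mono_cont (\<lambda>ns. dech v (\<lambda>us. Fun (sym_decode (length ns)) us))"
        by (simp add: mono_cont_def)
      moreover have "mono_cont k \<Longrightarrow> k (dec s # ws) \<rightarrow>* k (dec t # ws)" for k ws
        using ctxt.IH unfolding mono_cont_def by (metis append_Nil)
      ultimately show ?thesis using 1 ctxt.IH True by (auto intro: dech_mono)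
    next
      case 2
      have "mono_cont (\<lambda>us. Fun (sym_decode n) us)" for n
        by (simp add: mono_cont_def rsteps_ctxt)
      moreover have "mono_cont (\<lambda>us. k (a # us))" if "mono_cont k" for k a
        using that unfolding mono_cont_def by (metis append_Cons)
      ultimately show ?thesis using 2 ctxt.IH True by (auto intro: dech_mono)
    qed
  next
    case False
    then show ?thesis using ctxt.IH by (auto intro: rsteps_ctxt)
  qed
qed

lemma dec_steps: "s \<rightarrow>* t \<Longrightarrow> dec s \<rightarrow>* dec t"
  by (induction rule: rtrancl_induct) (auto dest: dec_step intro: rtrancl_trans)

lemma enc_subst: "syms l \<subseteq> sign R \<Longrightarrow> enc (subst \<sigma> l) = subst (\<lambda>x. enc (\<sigma> x)) l"
  by (induction l) (auto simp: UN_subset_iff)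

lemma chain_step: "s \<rightarrow>* t \<Longrightarrow> chain (us @ s # vs) \<rightarrow>* chain (us @ t # vs)"
proof (induction us)
  case Nil
  then show ?case using rsteps_ctxt[of s t R f "[]" "[chain vs]"] by simp
next
  case (Cons u us)
  then show ?case using rsteps_ctxt[of "chain (us @ s # vs)" _ R f "[u]" "[]"] by simp
qed

lemma enc_step: "(s, t) \<in> rstep R \<Longrightarrow> enc s \<rightarrow>* enc t"
proof (induction rule: rstep.induct)
  case (root l r \<sigma>)
  then have "syms l \<subseteq> sign R" "syms r \<subseteq> sign R" using is_trs_syms[OF trs] by auto
  then show ?case using root by (auto simp: enc_subst intro!: r_into_rtrancl rstep.root)
next
  case (ctxt s t g us vs)
  show ?case
  proof (cases "g \<in> sign R")
    case True
    then show ?thesis using ctxt.IH by (simp add: rsteps_ctxt)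
  next
    case False
    have "chain (map enc us @ enc s # map enc vs) \<rightarrow>* chain (map enc us @ enc t # map enc vs)"
      using ctxt.IH by (rule chain_step)
    from rsteps_ctxt[OF this, of f "[num (sym_code g)]" "[]"] show ?thesis using False by simp
  qed
qed

text \<open>Intermediate terms need not be encodings: \<open>dec_steps\<close> maps all of them, and
  \<open>dec_enc\<close> restores both ends.\<close>

lemma enc_steps_iff: "enc s \<rightarrow>* enc t \<longleftrightarrow> s \<rightarrow>* t"
proof
  assume "enc s \<rightarrow>* enc t"
  then show "s \<rightarrow>* t" using dec_steps by (fastforce simp: dec_enc)
next
  assume "s \<rightarrow>* t"
  then show "enc s \<rightarrow>* enc t"
    by (induction rule: rtrancl_induct) (auto dest: enc_step intro: rtrancl_trans)
qed

abbreviation \<Sigma> :: "sym set" where "\<Sigma> \<equiv> insert f (insert sharp (sign R))"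

lemma ground_chain: "chain ts \<in> ground_trms \<Sigma> \<longleftrightarrow> set ts \<subseteq> ground_trms \<Sigma>"
  by (induction ts) (auto simp: ground_Fun f sharp)

lemma ground_num: "num i \<in> ground_trms \<Sigma>"
  by (auto simp: ground_chain ground_Fun sharp)

lemma ground_enc: "t \<in> ground_trms \<Gamma> \<Longrightarrow> enc t \<in> ground_trms \<Sigma>"
proof (induction rule: ground_induct)
  case (Fun g ts)
  then show ?case using ground_num[of "sym_code g"] by (auto simp: ground_Fun ground_chain f)
qed

end

section \<open>Codes of terms and rules\<close>

text \<open>The arithmetic form of \<open>sum_encode (Inr _)\<close>, which
  \<open>rec_intros\<close> can handle. The argument code 0 in \<open>const_code\<close> is that of
  the empty list.\<close>

definition fun_code :: "nat \<Rightarrow> nat \<Rightarrow> nat" where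
  "fun_code g l = Suc (2 * prod_encode (g, l))"

abbreviation const_code :: "nat \<Rightarrow> nat" where
  "const_code a \<equiv> fun_code a 0"

lemma trm_code_Fun: "trm_code (Fun g ts) = fun_code (sym_code g) (list_encode (map trm_code ts))"
  by (simp add: fun_code_def sum_encode_def)

lemma trm_code_const: "trm_code (Fun g []) = const_code (sym_code g)"
  by (simp only: trm_code_Fun list.map list_encode.simps)

lemma recursive_fun_code [rec_intros]:
  "recursive F \<Longrightarrow> recursive G \<Longrightarrow> recursive (\<lambda>x. fun_code (F x) (G x))"
  unfolding fun_code_def by (intro rec_intros)

lemma list_decode_less: "a \<in> set (list_decode l) \<Longrightarrow> a < l"
proof (induction l rule: list_decode.induct)
  case (2 n)
  obtain b m where n: "prod_decode n = (b, m)" by (cases "prod_decode n")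
  have "b \<le> n" "m \<le> n" using le_prod_decode[of n] by (simp_all add: n)
  with 2 show ?case by (force simp: n)
qed simp

text \<open>Every number decodes to a term, possibly with wrong argument counts, so recursions on
  term codes need no test for validity.\<close>

function trm_decode :: "nat \<Rightarrow> trm" where
  "trm_decode n = (case sum_decode n of Inl x \<Rightarrow> Var x
    | Inr m \<Rightarrow> Fun (sym_decode (pfst m)) (map trm_decode (list_decode (psnd m))))"
  by auto

termination
proof (relation "Wellfounded.measure id")
  fix n m k
  assume "sum_decode n = Inr m" "k \<in> set (list_decode (psnd m))"
  moreover from this have "k < psnd m" by (simp add: list_decode_less)
  ultimately show "(k, n) \<in> Wellfounded.measure id"
    using le_prod_decode(2)[of m] by (auto simp: sum_decode_def split: if_splits)
qed simp

declare trm_decode.simps [simp del]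

lemma trm_decode_code [simp]: "trm_decode (trm_code t) = t"
proof (induction t)
  case (Fun g ts)
  then have "map (trm_decode \<circ> trm_code) ts = ts" by (simp add: map_idI)
  then show ?case by (simp add: trm_decode.simps[of "sum_encode _"])
qed (simp add: trm_decode.simps[of "sum_encode _"])

declare trm_code.simps(2) [simp del]

lemma inj_rule_code: "inj rule_code"
  by (rule inj_on_inverseI[of _ "\<lambda>n. (trm_decode (pfst n), trm_decode (psnd n))"])
    (simp add: rule_code_def)

section \<open>Runs of tree automata\<close>

abbreviation const :: "sym \<Rightarrow> trm" where
  "const a \<equiv> Fun a []"

definition eps :: "bta \<Rightarrow> (sym \<times> sym) set" where
  "eps C = {(a, b). a \<in> states C \<and> b \<in> states C \<and> (const a, const b) \<in> trans C}"

lemma bta_rule_cases: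
  assumes "is_bta \<Gamma> C" "(l, r) \<in> trans C"
  obtains (sym) d as a where "d \<in> \<Gamma>" "l = Fun d (map const as)" "r = const a"
      "length as = rank d" "set as \<subseteq> states C" "a \<in> states C"
    | (eps) a b where "l = const a" "r = const b" "(a, b) \<in> eps C"
proof -
  have "(l, r) \<in> {(Fun d (map const as), const a) | d as a.
          d \<in> \<Gamma> \<and> length as = rank d \<and> set as \<subseteq> states C \<and> a \<in> states C} \<union>
       {(const a, const a') | a a'. a \<in> states C \<and> a' \<in> states C}"
    using assms unfolding is_bta_def by blast
  then show thesis using assms(2) sym eps unfolding eps_def by blast
qed

text \<open>States lie outside \<open>\<Gamma>\<close>, so no rule for a symbol applies to a state,
  and a constant has no proper subterms to rewrite.\<close>

lemma bta_state_steps: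
  assumes C: "is_bta \<Gamma> C" and a: "a \<in> states C"
  shows "(const a, t) \<in> (rstep (trans C))\<^sup>* \<longleftrightarrow> (\<exists>b. t = const b \<and> (a, b) \<in> (eps C)\<^sup>*)"
proof
  assume "(const a, t) \<in> (rstep (trans C))\<^sup>*"
  then show "\<exists>b. t = const b \<and> (a, b) \<in> (eps C)\<^sup>*"
  proof (induction rule: rtrancl_induct)
    case (step t u)
    then obtain b where b: "t = const b" "(a, b) \<in> (eps C)\<^sup>*" by blast
    then have "b \<in> states C" using a by (auto simp: eps_def elim: rtranclE)
    from step.hyps(2) show ?case
    proof (cases rule: rstep.cases)
      case (root l r \<sigma>)
      from C \<open>(l, r) \<in> trans C\<close> show ?thesis
      proof (cases rule: bta_rule_cases)
        case (sym d as a)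
        then have "d = b" using root b by auto
        then show ?thesis using C sym \<open>b \<in> states C\<close> by (auto simp: is_bta_def)
      next
        case (eps a' b')
        then show ?thesis using root b by (auto intro: rtrancl_into_rtrancl)
      qed
    qed (use b in auto)
  qed auto
next
  assume "\<exists>b. t = const b \<and> (a, b) \<in> (eps C)\<^sup>*"
  then obtain b where b: "(a, b) \<in> (eps C)\<^sup>*" and t: "t = const b" by blast
  show "(const a, t) \<in> (rstep (trans C))\<^sup>*"
    unfolding t using b
  proof (induction rule: rtrancl_induct)
    case (step b c)
    then have "(const b, const c) \<in> trans C" by (auto simp: eps_def)
    from rstep.root[OF this, of Var] have "(const b, const c) \<in> rstep (trans C)" by simp
    with step.IH show ?case by (rule rtrancl_into_rtrancl)
  qed simp
qed

text \<open>A run works below the root until a rule for \<open>g\<close> fires there; afterwards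
  only rules between states apply. In the induction from the front, a step in an argument is
  prepended to the run of that argument.\<close>

lemma bta_Fun_steps:
  assumes C: "is_bta \<Gamma> C" and g: "g \<in> \<Gamma>" and a: "a \<in> states C"
  shows "(Fun g ts, const a) \<in> (rstep (trans C))\<^sup>* \<longleftrightarrow>
    (\<exists>as b. list_all2 (\<lambda>t c. c \<in> states C \<and> (t, const c) \<in> (rstep (trans C))\<^sup>*) ts as \<and>
      (Fun g (map const as), const b) \<in> trans C \<and> (b, a) \<in> (eps C)\<^sup>*)"
    (is "_ \<longleftrightarrow> (\<exists>as b. list_all2 ?reach ts as \<and> _ as b)")
proof
  let ?R = "rstep (trans C)"
  assume "(Fun g ts, const a) \<in> ?R\<^sup>*"
  moreover have "\<exists>as b. list_all2 ?reach ts as \<and> (Fun g (map const as), const b) \<in> trans C \<and>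
      (b, a) \<in> (eps C)\<^sup>*" if "(t, const a) \<in> ?R\<^sup>*" "t = Fun g ts" for t ts
    using that
  proof (induction arbitrary: ts rule: converse_rtrancl_induct)
    \<comment> \<open>Impossible: \<open>g\<close> belongs to \<open>\<Gamma>\<close> and
      \<open>a\<close> is a state.\<close>
    case base
    then show ?case using C g a by (auto simp: is_bta_def)
  next
    case (step t u)
    have g_state: "g \<notin> states C" using C g by (auto simp: is_bta_def)
    from step.hyps(1) show ?case
    proof (cases rule: rstep.cases)
      case (root l r \<sigma>)
      from C \<open>(l, r) \<in> trans C\<close> show ?thesis
      proof (cases rule: bta_rule_cases)
        case (sym d as b)
        then have "d = g" "ts = map const as" "u = const b"
          using root step.prems by (auto simp: comp_def)
        moreover have "(b, a) \<in> (eps C)\<^sup>*"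
          using bta_state_steps[OF C \<open>b \<in> states C\<close>] step.hyps(2) \<open>u = const b\<close> by auto
        ultimately show ?thesis using sym \<open>(l, r) \<in> trans C\<close>
          by (intro exI[of _ as] exI[of _ b]) (auto simp: list_all2_conv_all_nth)
      next
        case (eps a' b')
        then show ?thesis using root step.prems g_state by (auto simp: eps_def)
      qed
    next
      case (ctxt s s' h us vs)
      then have u: "u = Fun g (us @ s' # vs)" and ts: "ts = us @ s # vs" using step.prems by auto
      from step.IH[OF u] obtain as b where as: "list_all2 ?reach (us @ s' # vs) as"
        and b: "(Fun g (map const as), const b) \<in> trans C" "(b, a) \<in> (eps C)\<^sup>*" by blast
      have "list_all2 ?reach ts as"
        using as \<open>(s, s') \<in> ?R\<close> unfolding ts
        by (auto simp: list_all2_append1 list_all2_Cons1 intro!: converse_rtrancl_into_rtrancl)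
      with b show ?thesis by blast
    qed
  qed
  ultimately show "\<exists>as b. list_all2 ?reach ts as \<and> (Fun g (map const as), const b) \<in> trans C \<and>
      (b, a) \<in> (eps C)\<^sup>*" by blast
next
  let ?R = "rstep (trans C)"
  assume "\<exists>as b. list_all2 ?reach ts as \<and> (Fun g (map const as), const b) \<in> trans C \<and>
      (b, a) \<in> (eps C)\<^sup>*"
  then obtain as b where as: "list_all2 ?reach ts as"
    and rule: "(Fun g (map const as), const b) \<in> trans C" and b: "(b, a) \<in> (eps C)\<^sup>*" by blast
  have "(Fun g ts, Fun g (map const as)) \<in> ?R\<^sup>*"
    using as by (intro rsteps_args) (auto simp: list_all2_conv_all_nth)
  also have "(Fun g (map const as), const b) \<in> ?R"
    using rstep.root[OF rule] by (simp add: comp_def)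
  also have "b \<in> states C" using C rule by (cases rule: bta_rule_cases) (auto simp: eps_def)
  then have "(const b, const a) \<in> ?R\<^sup>*" using bta_state_steps[OF C] b by blast
  finally show "(Fun g ts, const a) \<in> ?R\<^sup>*" .
qed

section \<open>Computing runs on codes\<close>

definition eps_code :: "nat \<Rightarrow> nat \<Rightarrow> (nat \<times> nat) set" where
  "eps_code S D = {(a, b). a \<in> set_decode S \<and> b \<in> set_decode S \<and>
     prod_encode (const_code a, const_code b) \<in> set_decode D}"

definition closure :: "nat \<Rightarrow> nat \<Rightarrow> nat \<Rightarrow> nat" where
  "closure S D Q = set_encode ((eps_code S D)\<^sup>* `` set_decode Q)"

lemma closure_subset: "(eps_code S D)\<^sup>* `` set_decode Q \<subseteq> set_decode Q \<union> set_decode S"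
proof -
  have "b \<in> set_decode Q \<union> set_decode S" if "(a, b) \<in> (eps_code S D)\<^sup>*" "a \<in> set_decode Q" for a b
    using that by (induction rule: rtrancl_induct) (auto simp: eps_code_def)
  then show ?thesis by blast
qed

lemma finite_closure: "finite ((eps_code S D)\<^sup>* `` set_decode Q)"
  by (rule finite_subset[OF closure_subset]) simp

lemma set_decode_closure: "set_decode (closure S D Q) = (eps_code S D)\<^sup>* `` set_decode Q"
  unfolding closure_def by (simp add: finite_closure)

text \<open>\<open>set_encode\<close> sums distinct powers of two, so it is monotone, and a union
  costs at most the sum of the codes. The bound limits the search for sets in
  \<open>closure_eq\<close>.\<close>

lemma closure_le: "closure S D Q \<le> Q + S"
proof -
  have "closure S D Q \<le> set_encode (set_decode Q \<union> set_decode S)"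
    unfolding closure_def set_encode_def by (rule sum_mono2) (use closure_subset in auto)
  also have "\<dots> \<le> set_encode (set_decode Q) + set_encode (set_decode S)"
    unfolding set_encode_def by (simp add: sum_Un_nat)
  finally show ?thesis by simp
qed

text \<open>
  The closure is the least set that contains \<open>Q\<close> and is closed under \<open>eps_code S D\<close>. This turns
  reachability into a bounded quantification over codes of sets.
\<close>

lemma closure_eq:
  "closure S D Q = set_encode {b. b < Q + S \<and> (\<forall>X. X < Suc (Q + S) \<longrightarrow>
     (\<forall>a. a < Q \<longrightarrow> a \<in> set_decode Q \<longrightarrow> a \<in> set_decode X) \<longrightarrow>
     (\<forall>a. a < S \<longrightarrow> (\<forall>b. b < S \<longrightarrow> a \<in> set_decode S \<and> b \<in> set_decode S \<and>
       prod_encode (const_code a, const_code b) \<in> set_decode D \<and> a \<in> set_decode X \<longrightarrow>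
       b \<in> set_decode X)) \<longrightarrow> b \<in> set_decode X)}"
  (is "_ = set_encode {b. b < _ \<and> (\<forall>X. _ \<longrightarrow> ?sup X \<longrightarrow> ?cl X \<longrightarrow> _)}")
proof -
  have sup: "?sup X \<longleftrightarrow> set_decode Q \<subseteq> set_decode X" for X
    using mem_set_decode_less by blast
  have cl: "?cl X \<longleftrightarrow> (\<forall>(a, b) \<in> eps_code S D. a \<in> set_decode X \<longrightarrow> b \<in> set_decode X)" for X
    unfolding eps_code_def using mem_set_decode_less by blast
  have "b \<in> set_decode X" if X: "?sup X" "?cl X" and b: "b \<in> (eps_code S D)\<^sup>* `` set_decode Q"
    for X b
  proof -
    obtain a where ab: "(a, b) \<in> (eps_code S D)\<^sup>*" and a: "a \<in> set_decode Q"
      using b by blast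
    show ?thesis using ab
    proof (induction rule: rtrancl_induct)
      case base
      show ?case using a X(1) by (auto simp: sup)
    next
      case (step c d)
      then show ?case using X(2) unfolding cl by blast
    qed
  qed
  \<comment> \<open>The closure is itself one of the candidates \<open>X\<close>; instantiating
    \<open>X\<close> with it yields the converse inclusion.\<close>
  moreover have "?sup (closure S D Q)"
    unfolding sup set_decode_closure by auto
  moreover have "?cl (closure S D Q)"
    by (rule cl[THEN iffD2]) (auto simp: set_decode_closure intro: rtrancl_into_rtrancl)
  moreover have "b < Q + S" if "b \<in> (eps_code S D)\<^sup>* `` set_decode Q" for b
    using that closure_le[of S D Q] mem_set_decode_less[of b "closure S D Q"]
    by (simp add: set_decode_closure)
  moreover have "closure S D Q < Suc (Q + S)" using closure_le[of S D Q] by simp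
  ultimately have "(eps_code S D)\<^sup>* `` set_decode Q = {b. b < Q + S \<and> (\<forall>X. X < Suc (Q + S) \<longrightarrow>
      ?sup X \<longrightarrow> ?cl X \<longrightarrow> b \<in> set_decode X)}"
    unfolding set_decode_closure[symmetric] by blast
  then show ?thesis unfolding closure_def by (rule arg_cong)
qed

lemma recursive_closure [rec_intros]:
  assumes "recursive S" "recursive D" "recursive Q"
  shows "recursive (\<lambda>x. closure (S x) (D x) (Q x))"
  unfolding closure_eq by (intro rec_intros assms[THEN recursive.comp])

text \<open>The end of a run as split by \<open>bta_Fun_steps\<close>: one rule at the root, then
  rules between states.\<close>

definition targets :: "nat \<Rightarrow> nat \<Rightarrow> nat \<Rightarrow> nat \<Rightarrow> nat" where
  "targets S D g l = closure S D (set_encode {b. b < S \<and> b \<in> set_decode S \<and>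
     prod_encode (fun_code g l, const_code b) \<in> set_decode D})"

lemma recursive_targets [rec_intros]:
  assumes "recursive S" "recursive D" "recursive G" "recursive L"
  shows "recursive (\<lambda>x. targets (S x) (D x) (G x) (L x))"
  unfolding targets_def by (intro rec_intros assms[THEN recursive.comp])

lemma set_decode_targets: "set_decode (targets S D g l) =
  (eps_code S D)\<^sup>* `` {b \<in> set_decode S. prod_encode (fun_code g l, const_code b) \<in> set_decode D}"
proof -
  have eq: "{b. b < S \<and> b \<in> set_decode S \<and> P b} = {b \<in> set_decode S. P b}" for P
    using mem_set_decode_less by blast
  show ?thesis unfolding targets_def set_decode_closure eq by simp
qed

lemma targets_subset: "set_decode (targets S D g l) \<subseteq> set_decode S"
proof -
  have "set_encode {b. b < S \<and> b \<in> set_decode S \<and>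
      prod_encode (fun_code g l, const_code b) \<in> set_decode D} = X \<Longrightarrow> set_decode X \<subseteq> set_decode S" for X
    by auto
  then show ?thesis unfolding targets_def set_decode_closure using closure_subset by blast
qed

definition runs :: "bta \<Rightarrow> trm \<Rightarrow> nat set" where
  "runs C t = {sym_code a | a. a \<in> states C \<and> (t, const a) \<in> (rstep (trans C))\<^sup>*}"

lemma runs_Fun:
  assumes C: "is_bta \<Gamma> C" and g: "g \<in> \<Gamma>"
    and S: "S = alph_code (states C)" and D: "D = set_encode (rule_code ` trans C)"
  shows "runs C (Fun g ts) = {x. \<exists>as. list_all2 (\<lambda>t a. a \<in> runs C t) ts as \<and>
    x \<in> set_decode (targets S D (sym_code g) (list_encode (map const_code as)))}"
proof -
  have fin: "finite (states C)" "finite (trans C)" using C by (auto simp: is_bta_def)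
  then have S': "set_decode S = sym_code ` states C" and D': "set_decode D = rule_code ` trans C"
    by (simp_all add: S D alph_code_def)
  have rule: "prod_encode (trm_code l, trm_code r) \<in> set_decode D \<longleftrightarrow> (l, r) \<in> trans C" for l r
    using inj_image_mem_iff[OF inj_rule_code, of "(l, r)" "trans C"]
    unfolding D' by (simp add: rule_code_def)
  have eps: "eps_code S D = map_prod sym_code sym_code ` eps C"
    unfolding eps_code_def eps_def S'
    by (auto simp: rule trm_code_const[symmetric] image_iff)
  have "(sym_code a, x) \<in> (eps_code S D)\<^sup>* \<longleftrightarrow> (\<exists>b. x = sym_code b \<and> (a, b) \<in> (eps C)\<^sup>*)" for a x
  proof
    assume "(sym_code a, x) \<in> (eps_code S D)\<^sup>*"
    then show "\<exists>b. x = sym_code b \<and> (a, b) \<in> (eps C)\<^sup>*"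
      by (induction rule: rtrancl_induct)
        (auto simp: eps inj_eq[OF inj_sym_code] intro: rtrancl_into_rtrancl)
  next
    assume "\<exists>b. x = sym_code b \<and> (a, b) \<in> (eps C)\<^sup>*"
    then obtain b where b: "(a, b) \<in> (eps C)\<^sup>*" and x: "x = sym_code b" by blast
    show "(sym_code a, x) \<in> (eps_code S D)\<^sup>*" unfolding x using b
      by (induction rule: rtrancl_induct) (auto simp: eps intro: rtrancl_into_rtrancl)
  qed
  moreover have "prod_encode (fun_code (sym_code g) (list_encode (map const_code (map sym_code as))),
      const_code (sym_code b)) \<in> set_decode D \<longleftrightarrow> (Fun g (map const as), const b) \<in> trans C" for as b
    using rule[of "Fun g (map const as)" "const b"]
    by (simp only: trm_code_Fun[of g] trm_code_const map_map comp_def)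
  ultimately have targets: "set_decode (targets S D (sym_code g) (list_encode (map const_code (map sym_code as)))) =
      {sym_code a | a. \<exists>b\<in>states C. (Fun g (map const as), const b) \<in> trans C \<and> (b, a) \<in> (eps C)\<^sup>*}" for as
    unfolding set_decode_targets S' by (auto simp: Image_def)
  have rule_state: "b \<in> states C" if "(Fun g us, const b) \<in> trans C" for us b
    using C that by (cases rule: bta_rule_cases) (auto simp: eps_def)
  have eps_state: "b \<in> states C" if "(a, b) \<in> (eps C)\<^sup>*" "a \<in> states C" for a b
    using that by (auto simp: eps_def elim: rtranclE)
  have all2: "list_all2 (\<lambda>t a. a \<in> runs C t) ts xs \<longleftrightarrow>
      (\<exists>as. xs = map sym_code as \<and>
        list_all2 (\<lambda>t c. c \<in> states C \<and> (t, const c) \<in> (rstep (trans C))\<^sup>*) ts as)" for xs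
  proof
    assume *: "list_all2 (\<lambda>t a. a \<in> runs C t) ts xs"
    then have "list_all2 (\<lambda>t c. c \<in> states C \<and> (t, const c) \<in> (rstep (trans C))\<^sup>*) ts (map sym_decode xs)"
      by (auto simp: list_all2_conv_all_nth runs_def)
    then show "\<exists>as. xs = map sym_code as \<and>
        list_all2 (\<lambda>t c. c \<in> states C \<and> (t, const c) \<in> (rstep (trans C))\<^sup>*) ts as"
      by (intro exI[of _ "map sym_decode xs"]) (simp add: comp_def)
  qed (auto simp: list_all2_conv_all_nth runs_def)
  show ?thesis
  proof (intro set_eqI iffI)
    fix x
    assume "x \<in> runs C (Fun g ts)"
    then obtain a where x: "x = sym_code a" "a \<in> states C"
      and "(Fun g ts, const a) \<in> (rstep (trans C))\<^sup>*" by (auto simp: runs_def)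
    then obtain as b where "list_all2 (\<lambda>t c. c \<in> states C \<and> (t, const c) \<in> (rstep (trans C))\<^sup>*) ts as"
      "(Fun g (map const as), const b) \<in> trans C" "(b, a) \<in> (eps C)\<^sup>*"
      unfolding bta_Fun_steps[OF C g x(2)] by blast
    moreover from this rule_state have
      "x \<in> set_decode (targets S D (sym_code g) (list_encode (map const_code (map sym_code as))))"
      unfolding targets x by blast
    ultimately show "x \<in> {x. \<exists>as. list_all2 (\<lambda>t a. a \<in> runs C t) ts as \<and>
        x \<in> set_decode (targets S D (sym_code g) (list_encode (map const_code as)))}"
      unfolding all2 by blast
  next
    fix x
    assume "x \<in> {x. \<exists>as. list_all2 (\<lambda>t a. a \<in> runs C t) ts as \<and>
        x \<in> set_decode (targets S D (sym_code g) (list_encode (map const_code as)))}"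
    then obtain as a b where "list_all2 (\<lambda>t c. c \<in> states C \<and> (t, const c) \<in> (rstep (trans C))\<^sup>*) ts as"
      "x = sym_code a" "b \<in> states C" "(Fun g (map const as), const b) \<in> trans C" "(b, a) \<in> (eps C)\<^sup>*"
      unfolding all2 by (auto simp: targets simp del: map_map)
    moreover from this have "a \<in> states C" by (blast intro: eps_state)
    ultimately show "x \<in> runs C (Fun g ts)"
      unfolding runs_def using bta_Fun_steps[OF C g] by blast
  qed
qed

section \<open>Runs of the given automaton on blocks\<close>

context block_encoding
begin

text \<open>The transition at \<open>f\<close> in the subset construction.\<close>

definition join :: "nat \<Rightarrow> nat \<Rightarrow> nat \<Rightarrow> nat \<Rightarrow> nat" where
  "join S D P Q = set_encode {b. b < S \<and> (\<exists>p. p < P \<and> p \<in> set_decode P \<and>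
     (\<exists>q. q < Q \<and> q \<in> set_decode Q \<and>
       b \<in> set_decode (targets S D (sym_code f) (list_encode [const_code p, const_code q]))))}"

definition leaf :: "nat \<Rightarrow> nat \<Rightarrow> nat" where
  "leaf S D = targets S D (sym_code sharp) 0"

definition num_runs :: "nat \<Rightarrow> nat \<Rightarrow> nat \<Rightarrow> nat" where
  "num_runs S D i = rec_nat (leaf S D) (\<lambda>_ Q. join S D (leaf S D) Q) i"

text \<open>\<open>2 ^ a\<close> codes the set {a}: the states of the elements are prescribed, while
  the tail may be in any state of a set.\<close>

definition chain_runs :: "nat \<Rightarrow> nat \<Rightarrow> nat list \<Rightarrow> nat" where
  "chain_runs S D as = foldr (\<lambda>a Q. join S D (2 ^ a) Q) as (leaf S D)"

text \<open>Everything that happens inside of the block of \<open>g\<close> is computed here, so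
  that a single rule can replace it.\<close>

definition block_runs :: "nat \<Rightarrow> nat \<Rightarrow> nat \<Rightarrow> nat \<Rightarrow> nat" where
  "block_runs S D g l = (if g \<in> set_decode (alph_code (sign R))
     then targets S D g (list_encode (map const_code (list_decode l)))
     else join S D (num_runs S D g) (chain_runs S D (list_decode l)))"

lemma recursive_join [rec_intros]:
  assumes "recursive S" "recursive D" "recursive P" "recursive Q"
  shows "recursive (\<lambda>x. join (S x) (D x) (P x) (Q x))"
  unfolding join_def list_encode.simps by (intro rec_intros assms[THEN recursive.comp])

lemma recursive_block_runs [rec_intros]:
  assumes "recursive S" "recursive D" "recursive G" "recursive L"
  shows "recursive (\<lambda>x. block_runs (S x) (D x) (G x) (L x))"
  unfolding block_runs_def num_runs_def chain_runs_def leaf_def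
  by (intro rec_intros assms[THEN recursive.comp])

lemma set_decode_join: "set_decode (join S D P Q) = {b. \<exists>p\<in>set_decode P. \<exists>q\<in>set_decode Q.
    b \<in> set_decode (targets S D (sym_code f) (list_encode [const_code p, const_code q]))}"
proof -
  have "{b. b < S \<and> (\<exists>p. p < P \<and> p \<in> set_decode P \<and> (\<exists>q. q < Q \<and> q \<in> set_decode Q \<and>
       b \<in> set_decode (targets S D (sym_code f) (list_encode [const_code p, const_code q]))))} =
    {b. \<exists>p\<in>set_decode P. \<exists>q\<in>set_decode Q.
    b \<in> set_decode (targets S D (sym_code f) (list_encode [const_code p, const_code q]))}" (is "?A = ?B")
    using mem_set_decode_less targets_subset by blast
  moreover have "finite ?A" by simp
  ultimately show ?thesis unfolding join_def by (metis (no_types, lifting) set_encode_inverse)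
qed

context
  fixes C S D
  assumes C: "is_bta \<Sigma> C"
    and S: "S = alph_code (states C)" and D: "D = set_encode (rule_code ` trans C)"
begin

lemma runs_f: "runs C (Fun f [u, v]) = {b. \<exists>p\<in>runs C u. \<exists>q\<in>runs C v.
    b \<in> set_decode (targets S D (sym_code f) (list_encode [const_code p, const_code q]))}"
proof -
  have "list_all2 (\<lambda>t a. a \<in> runs C t) [u, v] as \<longleftrightarrow>
      (\<exists>p q. as = [p, q] \<and> p \<in> runs C u \<and> q \<in> runs C v)" for as
    by (auto simp: list_all2_Cons1)
  then have "runs C (Fun f [u, v]) = {b. \<exists>as. (\<exists>p q. as = [p, q] \<and> p \<in> runs C u \<and> q \<in> runs C v) \<and>
      b \<in> set_decode (targets S D (sym_code f) (list_encode (map const_code as)))}"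
    by (subst runs_Fun[OF C _ S D]) simp_all
  also have "\<dots> = {b. \<exists>p\<in>runs C u. \<exists>q\<in>runs C v. b \<in> set_decode (targets S D (sym_code f)
      (list_encode (map const_code [p, q])))}"
    by blast
  finally show ?thesis by (simp only: list.map)
qed

lemma runs_sharp: "runs C (Fun sharp []) = set_decode (leaf S D)"
  by (subst runs_Fun[OF C _ S D]) (auto simp: leaf_def)

lemma runs_num: "runs C (num i) = set_decode (num_runs S D i)"
  by (induction i) (simp_all add: num_runs_def runs_sharp runs_f set_decode_join)

lemma runs_chain: "runs C (chain ts) =
    {x. \<exists>as. list_all2 (\<lambda>t a. a \<in> runs C t) ts as \<and> x \<in> set_decode (chain_runs S D as)}"
proof (induction ts)
  case Nil
  show ?case by (simp add: chain_runs_def runs_sharp)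
next
  case (Cons t ts)
  have sing: "set_decode (2 ^ a) = {a}" for a
    using set_encode_inverse[of "{a}"] by (simp add: set_encode_def)
  have rec: "set_decode (chain_runs S D (a # as)) = {b. \<exists>q\<in>set_decode (chain_runs S D as).
      b \<in> set_decode (targets S D (sym_code f) (list_encode [const_code a, const_code q]))}" for a as
    by (simp add: chain_runs_def set_decode_join sing)
  show ?case
    unfolding chain.simps runs_f Cons.IH list_all2_Cons1 using rec by blast
qed

text \<open>Each argument occurs exactly once in the block, so a run on the block picks one state
  per argument. A nondeterministic automaton can therefore be pulled back without determinizing
  it.\<close>

lemma runs_enc: "runs C (enc (Fun g ts)) = {x. \<exists>as. list_all2 (\<lambda>t a. a \<in> runs C (enc t)) ts as \<and>
    x \<in> set_decode (block_runs S D (sym_code g) (list_encode as))}"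
proof -
  have "finite (sign R)" by (rule finite_sign[OF trs])
  then have mem: "sym_code g \<in> set_decode (alph_code (sign R)) \<longleftrightarrow> g \<in> sign R"
    by (simp add: alph_code_def inj_image_mem_iff[OF inj_sym_code])
  show ?thesis
  proof (cases "g \<in> sign R")
    case True
    then show ?thesis
      by (simp add: runs_Fun[OF C _ S D] block_runs_def mem list_all2_map1)
  next
    case False
    have "runs C (enc (Fun g ts)) = runs C (Fun f [num (sym_code g), chain (map enc ts)])"
      using False by simp
    also have "\<dots> = {b. \<exists>p\<in>set_decode (num_runs S D (sym_code g)). \<exists>q\<in>runs C (chain (map enc ts)).
        b \<in> set_decode (targets S D (sym_code f) (list_encode [const_code p, const_code q]))}"
      unfolding runs_f runs_num ..
    also have "\<dots> = {x. \<exists>as. list_all2 (\<lambda>t a. a \<in> runs C (enc t)) ts as \<and>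
        x \<in> set_decode (block_runs S D (sym_code g) (list_encode as))}"
      using False unfolding runs_chain
      by (auto simp: block_runs_def mem list_all2_map1 set_decode_join simp del: list_encode.simps)
    finally show ?thesis .
  qed
qed

end

end

section \<open>Bounds on codes of pairs and lists\<close>

lemma prod_encode_mono: "a \<le> c \<Longrightarrow> b \<le> d \<Longrightarrow> prod_encode (a, b) \<le> prod_encode (c, d)"
proof -
  assume le: "a \<le> c" "b \<le> d"
  have "mono triangle" by (intro monoI) (simp only: triangle_def div_le_mono mult_le_mono Suc_le_mono)
  then have "triangle (a + b) \<le> triangle (c + d)" by (rule monoD) (intro add_mono le)
  then show ?thesis using le by (simp add: prod_encode_def)
qed

text \<open>The code of the list of \<open>n\<close> copies of \<open>m\<close>; it limits the
  search for left-hand sides of new rules.\<close>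

definition list_bound :: "nat \<Rightarrow> nat \<Rightarrow> nat" where
  "list_bound m n = rec_nat 0 (\<lambda>_ y. Suc (prod_encode (m, y))) n"

lemma list_encode_le_bound:
  assumes "set us \<subseteq> {..m}" "length us \<le> n"
  shows "list_encode us \<le> list_bound m n"
  using assms
proof (induction us arbitrary: n)
  case (Cons u us)
  then obtain k where n: "n = Suc k" by (cases n) auto
  with Cons have "u \<le> m" "list_encode us \<le> list_bound m k" by auto
  then show ?case unfolding n by (simp add: list_bound_def prod_encode_mono)
qed simp

section \<open>The encoding is recursive\<close>

context block_encoding
begin

definition enc_code :: "nat \<Rightarrow> nat" where
  "enc_code n = trm_code (enc (trm_decode n))"

definition chain_code :: "nat list \<Rightarrow> nat" where
  "chain_code us = foldr (\<lambda>a u. fun_code (sym_code f) (list_encode [a, u])) us (const_code (sym_code sharp))"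

definition num_code :: "nat \<Rightarrow> nat" where
  "num_code i = rec_nat (const_code (sym_code sharp))
     (\<lambda>_ u. fun_code (sym_code f) (list_encode [const_code (sym_code sharp), u])) i"

lemma trm_code_chain: "trm_code (chain ts) = chain_code (map trm_code ts)"
  by (induction ts) (simp_all add: chain_code_def trm_code_Fun)

lemma num_code_eq: "num_code i = chain_code (replicate i (const_code (sym_code sharp)))"
  by (induction i) (simp_all add: num_code_def chain_code_def)

lemma sign_code: "sym_code g \<in> set_decode (alph_code (sign R)) \<longleftrightarrow> g \<in> sign R"
  by (simp add: alph_code_def finite_sign[OF trs] inj_image_mem_iff[OF inj_sym_code])

text \<open>Variables have even codes. Other terms have odd codes \<open>Suc n\<close>, where
  \<open>n div 2\<close> pairs the symbol with the argument list.\<close>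

lemma enc_code_Suc: "enc_code (Suc n) =
   (if odd n then Suc n
    else let g = pfst (n div 2); us = map enc_code (list_decode (psnd (n div 2))) in
      if g \<in> set_decode (alph_code (sign R)) then fun_code g (list_encode us)
      else fun_code (sym_code f) (list_encode [num_code g, chain_code us]))"
proof (cases "odd n")
  case True
  then show ?thesis
    by (auto simp: enc_code_def trm_decode.simps[of "Suc n"] sum_decode_def sum_encode_def)
next
  case False
  let ?g = "pfst (n div 2)" and ?ts = "map trm_decode (list_decode (psnd (n div 2)))"
  have "trm_decode (Suc n) = Fun (sym_decode ?g) ?ts"
    using False by (simp add: trm_decode.simps[of "Suc n"] sum_decode_def)
  moreover have "trm_code \<circ> (enc \<circ> trm_decode) = enc_code"
    by (simp add: enc_code_def fun_eq_iff)
  ultimately show ?thesis using False sign_code[of "sym_decode ?g"]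
    by (simp add: enc_code_def[of "Suc n"] trm_code_Fun trm_code_chain num_code_eq trm_code_const)
qed

lemma recursive_enc_code [rec_intros]:
  assumes "recursive l"
  shows "recursive (\<lambda>x. enc_code (l x))"
proof -
  \<comment> \<open>Every number is read both as a term and as a list of terms, which merges the
    mutual recursion into one. The term needs the encoded list at \<open>psnd (n div 2)\<close>; the
    list needs its head \<open>pfst n\<close> and its tail \<open>psnd n\<close>.\<close>
  define H where "H n = prod_encode (enc_code n, list_encode (map enc_code (list_decode n)))" for n
  define K where "K n a b c = prod_encode (if odd n then Suc n
    else if pfst (n div 2) \<in> set_decode (alph_code (sign R)) then fun_code (pfst (n div 2)) (psnd a)
    else fun_code (sym_code f) (list_encode [num_code (pfst (n div 2)), chain_code (list_decode (psnd a))]),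
    Suc (prod_encode (pfst b, psnd c)))" for n a b c
  have "recursive (\<lambda>x. H (l x))"
  proof (rule recursive_course_of_values[where F = "\<lambda>_. H" and x = "\<lambda>x. x" and n = l
        and p = "\<lambda>n. psnd (n div 2)" and q = pfst and r = psnd and G = "\<lambda>_. K"])
    show "H (Suc n) = K n (H (psnd (n div 2))) (H (pfst n)) (H (psnd n))" for n
      by (simp add: H_def K_def enc_code_Suc Let_def case_prod_unfold)
    show "psnd (n div 2) \<le> n" for n
      using le_prod_decode(2)[of "n div 2"] by (meson div_le_dividend order_trans)
    show "recursive (\<lambda>z. K (pfst (psnd z)) (pfst (psnd (psnd z))) (pfst (psnd (psnd (psnd z))))
        (psnd (psnd (psnd (psnd z)))))"
      unfolding K_def num_code_def chain_code_def list_encode.simps by (intro rec_intros)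
  qed (intro rec_intros assms le_prod_decode)+
  then have "recursive (\<lambda>x. pfst (H (l x)))" by (rule recursive_pfst)
  then show ?thesis by (simp add: H_def)
qed

lemma lang_code_enc:
  "finite L \<Longrightarrow> lang_code (enc ` L) = set_encode (enc_code ` {i. i < lang_code L \<and> i \<in> set_decode (lang_code L)})"
proof -
  assume "finite L"
  then have "{i. i < lang_code L \<and> i \<in> set_decode (lang_code L)} = trm_code ` L"
    using mem_set_decode_less by (auto simp: lang_code_def)
  then show ?thesis by (simp add: lang_code_def image_image enc_code_def)
qed

section \<open>The inverse image of a recognizable language\<close>

text \<open>The new code is at least \<open>G\<close>, whereas all codes of symbols in the alphabet
  coded by \<open>G\<close> are below \<open>G\<close>. Dropping the rank loses nothing, as states
  have rank 0.\<close>

definition rename :: "nat \<Rightarrow> nat \<Rightarrow> nat" where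
  "rename G x = prod_encode (pfst x + G, 0)"

abbreviation new_state :: "nat \<Rightarrow> nat \<Rightarrow> sym" where
  "new_state G x \<equiv> sym_decode (rename G x)"

text \<open>The closure in \<open>targets\<close> absorbs the rules between states, so rules for
  symbols are all that the new automaton gets.\<close>

definition new_rule :: "nat \<Rightarrow> nat \<Rightarrow> nat \<Rightarrow> nat \<Rightarrow> nat list \<Rightarrow> nat \<Rightarrow> bool" where
  "new_rule G S D g as a \<longleftrightarrow> g \<in> set_decode G \<and> length as = psnd g \<and> (\<forall>a\<in>set as. a \<in> set_decode S) \<and>
     a \<in> set_decode S \<and> a \<in> set_decode (block_runs S D g (list_encode as))"

text \<open>
  All arguments are codes: \<open>G\<close> of the alphabet, \<open>S\<close>, \<open>A\<close> and \<open>D\<close> of the three components of an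
  automaton. States are shifted by \<open>G\<close> because the old ones may belong to the alphabet \<open>G\<close>.
\<close>

definition pullback :: "nat \<Rightarrow> nat \<Rightarrow> nat \<Rightarrow> nat \<Rightarrow> bta" where
  "pullback G S A D = \<lparr>states = new_state G ` set_decode S, finals = new_state G ` set_decode A,
     trans = {(Fun (sym_decode g) (map (\<lambda>x. const (new_state G x)) as), const (new_state G a)) | g as a.
       new_rule G S D g as a}\<rparr>"

lemma recursive_pullback:
  assumes "recursive G" "recursive S" "recursive A" "recursive D"
  shows "recursive (\<lambda>x. bta_code (pullback (G x) (S x) (A x) (D x)))"
proof -
  let ?h = "\<lambda>G z. prod_encode (fun_code (pfst z)
    (list_encode (map (\<lambda>x. const_code (rename G x)) (list_decode (pfst (psnd z))))),
    const_code (rename G (psnd (psnd z))))"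
  let ?B = "\<lambda>G S. Suc (prod_encode (G, prod_encode (list_bound S G, S)))"
  let ?P = "\<lambda>G S D z. new_rule G S D (pfst z) (list_decode (pfst (psnd z))) (psnd (psnd z))"
  have set_eq: "set_decode N = {i. i < N \<and> i \<in> set_decode N}" for N
    using mem_set_decode_less by blast
  \<comment> \<open>The entries of \<open>as\<close> are states, hence at most \<open>S\<close>;
    their number is the rank of the symbol, hence at most \<open>g\<close>, which is at most
    \<open>G\<close>.\<close>
  have bound: "prod_encode (g, prod_encode (list_encode as, a)) < ?B G S" if "new_rule G S D g as a" for G S D g as a
  proof -
    have g: "g \<le> G" and a: "a \<le> S" and as: "set as \<subseteq> {..S}"
      using that mem_set_decode_less unfolding new_rule_def by (auto intro: less_imp_le)
    have "length as \<le> G" using that g le_prod_decode(2)[of g] by (simp add: new_rule_def)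
    then show ?thesis using g a list_encode_le_bound[OF as]
      by (simp add: less_Suc_eq_le prod_encode_mono)
  qed
  have "bta_code (pullback G S A D) = prod_encode (set_encode (rename G ` set_decode S),
      prod_encode (set_encode (rename G ` set_decode A),
        set_encode (?h G ` {z. z < ?B G S \<and> ?P G S D z})))" for G S A D
  proof -
    have "rule_code ` trans (pullback G S A D) = ?h G ` {z. z < ?B G S \<and> ?P G S D z}"
    proof (intro set_eqI iffI)
      fix x
      assume "x \<in> rule_code ` trans (pullback G S A D)"
      then obtain g as a where nr: "new_rule G S D g as a"
        and x: "x = ?h G (prod_encode (g, prod_encode (list_encode as, a)))"
        by (auto simp: pullback_def rule_code_def trm_code_Fun comp_def)
      show "x \<in> ?h G ` {z. z < ?B G S \<and> ?P G S D z}"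
        unfolding x by (rule imageI) (use nr bound[OF nr] in simp)
    next
      fix x
      assume "x \<in> ?h G ` {z. z < ?B G S \<and> ?P G S D z}"
      then obtain z where z: "?P G S D z" and x: "x = ?h G z" by blast
      have "x = rule_code (Fun (sym_decode (pfst z)) (map (\<lambda>x. const (new_state G x)) (list_decode (pfst (psnd z)))),
          const (new_state G (psnd (psnd z))))"
        by (simp add: x rule_code_def trm_code_Fun comp_def)
      with z show "x \<in> rule_code ` trans (pullback G S A D)" by (auto simp: pullback_def)
    qed
    then show ?thesis by (simp add: bta_code_def pullback_def alph_code_def image_image)
  qed
  then have eq: "bta_code (pullback G S A D) =
    prod_encode (set_encode ((\<lambda>i. rename G i) ` {i. i < S \<and> i \<in> set_decode S}),
      prod_encode (set_encode ((\<lambda>i. rename G i) ` {i. i < A \<and> i \<in> set_decode A}),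
        set_encode (?h G ` {z. z < ?B G S \<and> ?P G S D z})))" for G S A D
    by (simp flip: set_eq)
  show ?thesis
    \<comment> \<open>\<open>list_decode_inverse\<close> removes the round trip that arises because
      \<open>new_rule\<close> encodes a list that was just decoded.\<close>
    unfolding eq rename_def new_rule_def list_bound_def list_decode_inverse
    by (intro rec_intros assms assms[THEN recursive.comp])
qed

lemma pullback:
  assumes C: "is_bta \<Sigma> C" and \<Gamma>: "finite \<Gamma>"
    and G: "G = alph_code \<Gamma>" and S: "S = alph_code (states C)" and A: "A = alph_code (finals C)"
    and D: "D = set_encode (rule_code ` trans C)"
  shows is_bta_pullback: "is_bta \<Gamma> (pullback G S A D)"
    and bta_lang_pullback: "bta_lang \<Gamma> (pullback G S A D) = {p \<in> ground_trms \<Gamma>. enc p \<in> bta_lang \<Sigma> C}"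
proof -
  let ?C = "pullback G S A D"
  have fin: "finite (states C)" "finite (finals C)"
    using C by (auto simp: is_bta_def intro: finite_subset)
  have G': "set_decode G = sym_code ` \<Gamma>" and S': "set_decode S = sym_code ` states C"
    and A': "set_decode A = sym_code ` finals C"
    using \<Gamma> fin by (simp_all add: G S A alph_code_def)
  have rank_new: "rank (new_state G x) = 0" for x by (simp add: rename_def sym_decode_def)
  have rank_dec: "rank (sym_decode g) = psnd g" for g by (simp add: sym_decode_def)
  have inj: "x = y" if "new_state G x = new_state G y" "x \<in> set_decode S" "y \<in> set_decode S" for x y
  proof -
    have "psnd x = 0" "psnd y = 0" "pfst x = pfst y"
      using that C by (auto simp: S' is_bta_def sym_decode_def rename_def) (metis rank_dec sym_decode_code)+
    then show ?thesis by (metis prod_decode_eq prod.expand)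
  qed
  have fresh: "new_state G x \<notin> \<Gamma>" for x
  proof
    assume "new_state G x \<in> \<Gamma>"
    then have "sym_code (new_state G x) < G" using G' mem_set_decode_less by blast
    then show False using le_prod_encode_1[of "pfst x + G" 0] by (simp add: rename_def)
  qed
  have nr: "g \<in> set_decode G \<Longrightarrow> sym_decode g \<in> \<Gamma>" for g by (auto simp: G')
  have "finite {(g, as, a). new_rule G S D g as a}"
  proof (rule finite_subset)
    show "{(g, as, a). new_rule G S D g as a} \<subseteq>
        set_decode G \<times> {as. set as \<subseteq> set_decode S \<and> length as \<le> G} \<times> set_decode S"
    proof clarify
      fix g as a
      assume *: "new_rule G S D g as a"
      then have "g < G" by (auto simp: new_rule_def intro: mem_set_decode_less)
      then have "length as \<le> G" using * le_prod_decode(2)[of g] by (simp add: new_rule_def)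
      with * show "g \<in> set_decode G \<and>
          (as, a) \<in> {as. set as \<subseteq> set_decode S \<and> length as \<le> G} \<times> set_decode S"
        by (auto simp: new_rule_def)
    qed
    show "finite (set_decode G \<times> {as. set as \<subseteq> set_decode S \<and> length as \<le> G} \<times> set_decode S)"
      by (intro finite_cartesian_product finite_lists_length_le) auto
  qed
  then have fin_trans: "finite (trans ?C)"
    by (rule finite_surj[where f = "\<lambda>(g, as, a). (Fun (sym_decode g) (map (\<lambda>x. const (new_state G x)) as),
      const (new_state G a))"]) (force simp: pullback_def)
  have trans: "trans ?C \<subseteq> {(Fun d (map const as), const a) | d as a.
      d \<in> \<Gamma> \<and> length as = rank d \<and> set as \<subseteq> states ?C \<and> a \<in> states ?C}"
  proof
    fix \<rho>
    assume "\<rho> \<in> trans ?C"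
    then obtain g as a where "new_rule G S D g as a"
      and \<rho>: "\<rho> = (Fun (sym_decode g) (map const (map (new_state G) as)), const (new_state G a))"
      by (auto simp: pullback_def comp_def)
    then have "sym_decode g \<in> \<Gamma>" "length (map (new_state G) as) = rank (sym_decode g)"
      "set (map (new_state G) as) \<subseteq> states ?C" "new_state G a \<in> states ?C"
      by (auto simp: new_rule_def nr rank_dec pullback_def)
    with \<rho> show "\<rho> \<in> {(Fun d (map const as), const a) | d as a.
      d \<in> \<Gamma> \<and> length as = rank d \<and> set as \<subseteq> states ?C \<and> a \<in> states ?C}" by blast
  qed
  have "finals C \<subseteq> states C" using C by (simp add: is_bta_def)
  then have AS: "set_decode A \<subseteq> set_decode S" by (auto simp: A' S')
  show bta: "is_bta \<Gamma> ?C"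
    unfolding is_bta_def
  proof (intro conjI)
    show "trans ?C \<subseteq> {(Fun d (map const as), const a) | d as a.
      d \<in> \<Gamma> \<and> length as = rank d \<and> set as \<subseteq> states ?C \<and> a \<in> states ?C} \<union>
      {(const a, const a') | a a'. a \<in> states ?C \<and> a' \<in> states ?C}" using trans by blast
  qed (use fin_trans fresh rank_new AS in \<open>auto simp: pullback_def\<close>)
  \<comment> \<open>A constant on a left-hand side comes from \<open>\<Gamma>\<close> and so is no
    state; the final phase of every run of the new automaton is empty.\<close>
  have "(const a, const b) \<notin> trans ?C" if "a \<in> states ?C" for a b
  proof
    assume "(const a, const b) \<in> trans ?C"
    then have "a \<in> \<Gamma>" using trans by auto
    then show False using that fresh by (auto simp: pullback_def)
  qed
  then have "eps ?C = {}" by (auto simp: eps_def)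
  then have eps: "(eps ?C)\<^sup>* = Id" by simp
  have runs_S: "runs C t \<subseteq> set_decode S" for t by (auto simp: runs_def S')
  have rule: "(Fun g (map const bs), const (new_state G x)) \<in> trans ?C \<longleftrightarrow>
      (\<exists>as. bs = map (new_state G) as \<and> new_rule G S D (sym_code g) as x)" if "x \<in> set_decode S" for g bs x
  proof
    assume "(Fun g (map const bs), const (new_state G x)) \<in> trans ?C"
    then obtain h as a where nr: "new_rule G S D h as a"
      and g: "g = sym_decode h" and bs: "map const bs = map const (map (new_state G) as)"
      and x: "new_state G x = new_state G a"
      by (auto simp: pullback_def comp_def)
    have "a \<in> set_decode S" using nr by (simp add: new_rule_def)
    then have "x = a" using inj x that by blast
    moreover have "bs = map (new_state G) as" using bs by (rule map_injective) (auto intro: injI)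
    ultimately show "\<exists>as. bs = map (new_state G) as \<and> new_rule G S D (sym_code g) as x"
      using nr g by auto
  next
    assume "\<exists>as. bs = map (new_state G) as \<and> new_rule G S D (sym_code g) as x"
    then obtain as where "bs = map (new_state G) as" "new_rule G S D (sym_code g) as x" by blast
    then show "(Fun g (map const bs), const (new_state G x)) \<in> trans ?C"
      unfolding pullback_def by (force simp: comp_def)
  qed
  \<comment> \<open>The invariant of the construction: a renamed state at \<open>p\<close> stands
    for the original state at the root of \<open>enc p\<close>.\<close>
  have run: "(p, const (new_state G x)) \<in> (rstep (trans ?C))\<^sup>* \<longleftrightarrow> x \<in> runs C (enc p)"
    if "p \<in> ground_trms \<Gamma>" "x \<in> set_decode S" for p x
    using that
  proof (induction p arbitrary: x rule: ground_induct)
    case (Fun g ts)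
    let ?reach = "\<lambda>t c. c \<in> states ?C \<and> (t, const c) \<in> (rstep (trans ?C))\<^sup>*"
    have all2: "list_all2 ?reach ts (map (new_state G) as) \<longleftrightarrow> list_all2 (\<lambda>t a. a \<in> runs C (enc t)) ts as"
      if "set as \<subseteq> set_decode S" for as
      using that Fun.IH by (auto simp: list_all2_conv_all_nth pullback_def subset_iff)
    have set_as: "set as \<subseteq> set_decode S" if "list_all2 (\<lambda>t a. a \<in> runs C (enc t)) ts as" for as
      using that runs_S by (fastforce simp: list_all2_conv_all_nth in_set_conv_nth)
    have "(Fun g ts, const (new_state G x)) \<in> (rstep (trans ?C))\<^sup>* \<longleftrightarrow>
        (\<exists>bs. list_all2 ?reach ts bs \<and> (Fun g (map const bs), const (new_state G x)) \<in> trans ?C)"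
      using Fun.prems Fun.hyps by (subst bta_Fun_steps[OF bta]) (auto simp: pullback_def eps[unfolded pullback_def])
    also have "\<dots> \<longleftrightarrow> (\<exists>as. list_all2 ?reach ts (map (new_state G) as) \<and> new_rule G S D (sym_code g) as x)"
      unfolding rule[OF Fun.prems] by blast
    also have "\<dots> \<longleftrightarrow> (\<exists>as. list_all2 (\<lambda>t a. a \<in> runs C (enc t)) ts as \<and>
        x \<in> set_decode (block_runs S D (sym_code g) (list_encode as)))"
    proof (intro ex_cong1)
      fix as
      have "psnd (sym_code g) = rank g" by (cases g) simp
      then have "new_rule G S D (sym_code g) as x \<longleftrightarrow>
          length as = length ts \<and> set as \<subseteq> set_decode S \<and>
          x \<in> set_decode (block_runs S D (sym_code g) (list_encode as))"
        using Fun.hyps Fun.prems by (auto simp: new_rule_def G')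
      moreover have "length as = length ts" if "list_all2 (\<lambda>t a. a \<in> runs C (enc t)) ts as"
        using list_all2_lengthD[OF that] by simp
      ultimately show "(list_all2 ?reach ts (map (new_state G) as) \<and> new_rule G S D (sym_code g) as x) =
        (list_all2 (\<lambda>t a. a \<in> runs C (enc t)) ts as \<and>
        x \<in> set_decode (block_runs S D (sym_code g) (list_encode as)))"
        using all2[of as] set_as[of as] by argo
    qed
    also have "\<dots> \<longleftrightarrow> x \<in> runs C (enc (Fun g ts))"
      unfolding runs_enc[OF C S D] by blast
    finally show ?case .
  qed
  have "(\<exists>a\<in>finals ?C. (p, const a) \<in> (rstep (trans ?C))\<^sup>*) \<longleftrightarrow>
      (\<exists>a\<in>finals C. (enc p, const a) \<in> (rstep (trans C))\<^sup>*)" if "p \<in> ground_trms \<Gamma>" for p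
  proof -
    have "(\<exists>a\<in>finals ?C. (p, const a) \<in> (rstep (trans ?C))\<^sup>*) \<longleftrightarrow> (\<exists>x\<in>set_decode A. x \<in> runs C (enc p))"
      using run[OF that] AS by (auto simp: pullback_def)
    also have "\<dots> \<longleftrightarrow> (\<exists>a\<in>finals C. (enc p, const a) \<in> (rstep (trans C))\<^sup>*)"
      using \<open>finals C \<subseteq> states C\<close> by (auto simp: A' runs_def inj_eq[OF inj_sym_code])
    finally show ?thesis .
  qed
  then show "bta_lang \<Gamma> ?C = {p \<in> ground_trms \<Gamma>. enc p \<in> bta_lang \<Sigma> C}"
    using ground_enc by (auto simp: bta_lang_def)
qed

text \<open>By \<open>ground_rsteps\<close> the reducts of \<open>L\<close> are ground over
  \<open>\<Gamma>\<close>, so restricting to ground terms loses none of them.\<close>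

lemma descendants_enc:
  assumes "sign R \<subseteq> \<Gamma>" "L \<subseteq> ground_trms \<Gamma>"
  shows "{p \<in> ground_trms \<Gamma>. enc p \<in> descendants R (enc ` L)} = descendants R L"
  using assms ground_rsteps[OF _ trs assms(1)] by (auto simp: descendants_def enc_steps_iff)

text \<open>The encoded language and the automaton for its descendants do not depend on the
  alphabet, which enters only in \<open>pullback\<close>. So the one algorithm for
  \<open>\<Sigma>\<close> serves all alphabets.\<close>

lemma EPRF_TRS_if_EPGRF_TRS:
  assumes "EPGRF_TRS \<Sigma> R"
  shows "EPRF_TRS R"
proof -
  obtain F where F: "recursive F" and L: "\<forall>L. finite L \<and> L \<subseteq> ground_trms \<Sigma> \<longrightarrow>
      (\<exists>C. is_bta \<Sigma> C \<and> F (lang_code L) = bta_code C \<and> bta_lang \<Sigma> C = descendants R L)"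
    using assms unfolding EPGRF_TRS_def by blast
  define H where "H n = F (set_encode (enc_code ` {i. i < n \<and> i \<in> set_decode n}))" for n
  have H: "recursive (\<lambda>x. H (h x))" if "recursive h" for h
    unfolding H_def by (intro rec_intros recursive.comp[OF F] that that[THEN recursive.comp])
  have "recursive (\<lambda>n. bta_code (pullback (pfst n) (pfst (H (psnd n))) (pfst (psnd (H (psnd n))))
      (psnd (psnd (H (psnd n))))))"
    by (intro rec_intros recursive_pullback H)
  moreover have "\<exists>C. is_bta \<Gamma> C \<and> bta_code (pullback (alph_code \<Gamma>) (pfst (H (lang_code L)))
      (pfst (psnd (H (lang_code L)))) (psnd (psnd (H (lang_code L))))) = bta_code C \<and>
      bta_lang \<Gamma> C = descendants R L"
    if "finite \<Gamma>" "sign R \<subseteq> \<Gamma>" "finite L" "L \<subseteq> ground_trms \<Gamma>" for \<Gamma> L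
  proof -
    have "finite (enc ` L) \<and> enc ` L \<subseteq> ground_trms \<Sigma>"
      using that ground_enc by auto
    from L[rule_format, OF this] obtain C where C: "is_bta \<Sigma> C" and code: "F (lang_code (enc ` L)) = bta_code C"
      and lang: "bta_lang \<Sigma> C = descendants R (enc ` L)" by blast
    have "H (lang_code L) = bta_code C" using code that(3) by (simp add: H_def lang_code_enc)
    then show ?thesis
      using is_bta_pullback[OF C that(1) refl refl refl refl]
        bta_lang_pullback[OF C that(1) refl refl refl refl] lang descendants_enc[OF that(2,4)]
      by (intro exI[of _ "pullback (alph_code \<Gamma>) (alph_code (states C)) (alph_code (finals C))
        (set_encode (rule_code ` trans C))"]) (simp add: bta_code_def)
  qed
  ultimately show ?thesis unfolding EPRF_TRS_def
    by (intro exI[of _ "\<lambda>n. bta_code (pullback (pfst n) (pfst (H (psnd n))) (pfst (psnd (H (psnd n))))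
      (psnd (psnd (H (psnd n)))))"]) simp
qed

end

text \<open>For a fixed \<open>\<Gamma>\<close> the number \<open>alph_code \<Gamma>\<close> is a
  constant that can be built into the algorithm.\<close>

lemma EPGRF_TRS_if_EPRF_TRS:
  assumes "EPRF_TRS R" "finite \<Gamma>" "sign R \<subseteq> \<Gamma>"
  shows "EPGRF_TRS \<Gamma> R"
proof -
  obtain F where F: "recursive F" and L: "\<forall>\<Gamma> L. finite \<Gamma> \<and> sign R \<subseteq> \<Gamma> \<and>
      finite L \<and> L \<subseteq> ground_trms \<Gamma> \<longrightarrow> (\<exists>C. is_bta \<Gamma> C \<and>
      F (prod_encode (alph_code \<Gamma>, lang_code L)) = bta_code C \<and> bta_lang \<Gamma> C = descendants R L)"
    using assms(1) unfolding EPRF_TRS_def by blast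
  have "recursive (\<lambda>n. F (prod_encode (alph_code \<Gamma>, n)))"
    by (intro rec_intros recursive.comp[OF F])
  then show ?thesis unfolding EPGRF_TRS_def
    using L assms(2,3) by (intro exI[of _ "\<lambda>n. F (prod_encode (alph_code \<Gamma>, n))"]) simp
qed

theorem mainTheorem17:
  fixes R :: rules and f sharp :: sym and \<Sigma> :: "sym set"
  assumes "is_trs R"
    and "rank f = 2" and "f \<notin> sign R"
    and "rank sharp = 0" and "sharp \<notin> sign R"
    and "\<Sigma> = {f, sharp} \<union> sign R"
  shows "EPGRF_TRS \<Sigma> R \<longleftrightarrow> EPRF_TRS R"
proof
  interpret block_encoding R f sharp using assms by unfold_locales
  assume "EPGRF_TRS \<Sigma> R"
  then show "EPRF_TRS R" using EPRF_TRS_if_EPGRF_TRS assms(6) by simp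
next
  assume "EPRF_TRS R"
  then show "EPGRF_TRS \<Sigma> R"
    using finite_sign[OF assms(1)] assms(6) by (intro EPGRF_TRS_if_EPRF_TRS) auto
qed

end
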